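(* Let $m>n$ and $\widetilde{m}=m-n$. Let $\mathcal{C}_1\subseteq\mathbb{F}_{q^{\widetilde{m}}}^n$ be a linear code over $\mathbb{F}_{q^{\widetilde m}}$, $\mathcal{C}_2\subsetneqq\mathcal{C}_1$ a subcode with $\dim\mathcal{C}_2=\dim\mathcal{C}_1-l$, $l\ge 1$, and $\psi:\mathbb{F}_{q^{\widetilde m}}^l\to\mathcal{C}_1/\mathcal{C}_2$ a linear bijection. Let $t\ge0$, $0\le\rho\le n$, and $N\ge n-\rho$ be integers. Then the lifting construction of the nested coset coding scheme $(\mathcal{C}_1,\mathcal{C}_2,\psi)$ is universally $t$-error-$\rho$-erasure-correcting (in the noncoherent setting, i.e. with the transfer matrix unknown to the receiver) if and only if $M_{R,1}(\mathcal{C}_1,\mathcal{C}_2)>2t+\rho$.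
   Context: For $r\ge1$, $\mathbb{F}_{q^r}$ is the degree-$r$ extension of the finite field $\mathbb{F}_q$. Dimensions of $\mathcal{C}_1,\mathcal{C}_2$ are over $\mathbb{F}_{q^{\widetilde m}}$. For a subspace $V\subseteq\mathbb{F}_{q^{\widetilde m}}^n$ put $V^q=\{[v_1^q,\dots,v_n^q]: v\in V\}$, and let $\Gamma$ be the set of $\mathbb{F}_{q^{\widetilde m}}$-subspaces $V\subseteq\mathbb{F}_{q^{\widetilde m}}^n$ with $V=V^q$. The first relative generalized rank weight is $M_{R,1}(\mathcal{C}_1,\mathcal{C}_2)=\min\{\dim V: V\in\Gamma,\ \dim(\mathcal{C}_1\cap V)-\dim(\mathcal{C}_2\cap V)\ge 1\}$. Lifting construction: fix an $\mathbb{F}_q$-linear isomorphism $\phi:\mathbb{F}_{q^{\widetilde m}}\to\mathbb{F}_q^{\widetilde m\times1}$ and for $\widetilde X=[\widetilde X_1,\dots,\widetilde X_n]\in\mathbb{F}_{q^{\widetilde m}}^n$ let $\phi(\widetilde X)=[\phi(\widetilde X_1),\dots,\phi(\widetilde X_n)]\in\mathbb{F}_q^{\widetilde m\times n}$. A message $S\in\mathbb{F}_{q^{\widetilde m}}^l$ is encoded as some element of $$\mathcal{X}_S=\left\{X=\begin{bmatrix} I\\ \phi(\widetilde X)\end{bmatrix}\in\mathbb{F}_q^{m\times n}:\widetilde X\in\psi(S)\right\},$$ $I$ being the $n\times n$ identity matrix. The sink receives $Y^{\rm T}=AX^{\rm T}+DZ^{\rm T}\in\mathbb{F}_q^{N\times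 m}$, where $A\in\mathbb{F}_q^{N\times n}$ is the transfer matrix, $D\in\mathbb{F}_q^{N\times t}$ and $Z\in\mathbb{F}_q^{m\times t}$ (the $t$ error packets). Universally $t$-error-$\rho$-erasure-correcting in the noncoherent setting means that $S$ is uniquely determined by $Y$ alone, for all $A\in\mathbb{F}_q^{N\times n}$ with $\operatorname{rank}A\ge n-\rho$, all $X\in\mathcal{X}_S$, all $D$ and all $Z$; that is, there are no $S\ne S'$, $X\in\mathcal{X}_S$, $X'\in\mathcal{X}_{S'}$, $A,A'\in\mathbb{F}_q^{N\times n}$ of rank at least $n-\rho$, $D,D'\in\mathbb{F}_q^{N\times t}$, $Z,Z'\in\mathbb{F}_q^{m\times t}$ with $AX^{\rm T}+DZ^{\rm T}=A'X'^{\rm T}+D'Z'^{\rm T}$. *)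

theory Defs
  imports "HOL-Algebra.AbelCoset" "Jordan_Normal_Form.DL_Rank" "HOL-Library.Cardinality"
begin

text \<open>
  Throughout, \<open>'k\<close> is the finite field with \<open>q = CARD('k)\<close> elements, and \<open>'e\<close> is its extension of
  degree \<open>r\<close>, embedded by \<open>emb\<close>. Row vectors of length \<open>n\<close> over \<open>'e\<close> are elements of
  \<open>carrier_vec n\<close>.
\<close>

definition finite_field_extension ::
    "('k :: {field, finite} \<Rightarrow> 'e :: {field, finite}) \<Rightarrow> nat \<Rightarrow> bool" where
  "finite_field_extension emb r \<longleftrightarrow> field_hom emb \<and> CARD('e) = CARD('k) ^ r"

text \<open>Isomorphism, linear over the base field, from the extension onto column vectors of length \<open>r\<close>.\<close>

definition base_linear_iso ::
    "('k :: field \<Rightarrow> 'e :: field) \<Rightarrow> nat \<Rightarrow> ('e \<Rightarrow> 'k vec) \<Rightarrow> bool" where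
  "base_linear_iso emb r \<phi> \<longleftrightarrow>
     bij_betw \<phi> UNIV (carrier_vec r) \<and>
     (\<forall>x y. \<phi> (x + y) = \<phi> x + \<phi> y) \<and>
     (\<forall>c x. \<phi> (emb c * x) = c \<cdot>\<^sub>v \<phi> x)"

abbreviation linear_code :: "nat \<Rightarrow> 'e :: field vec set \<Rightarrow> bool" where
  "linear_code n C \<equiv> subspace class_ring C (module_vec TYPE('e) n)"

definition subspace_dim :: "nat \<Rightarrow> 'e :: field vec set \<Rightarrow> nat" where
  "subspace_dim n V = vectorspace.dim class_ring ((module_vec TYPE('e) n)\<lparr>carrier := V\<rparr>)"

text \<open>
  Elements of the quotient are the cosets \<open>W +> v\<close>. The product of a scalar \<open>c\<close> and a coset \<open>X\<close> is
  the coset containing \<open>c \<odot> x\<close> for every \<open>x \<in> X\<close>; the pointwise product would be \<open>{0}\<close> instead of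
  \<open>W\<close> for \<open>c = 0\<close>. The ring fields \<open>mult\<close> and \<open>one\<close> of a module record have no meaning.
\<close>

definition quotient_module ::
    "('a, 'b, 'c) module_scheme \<Rightarrow> 'b set \<Rightarrow> ('a, 'b set) module" where
  "quotient_module M W =
     \<lparr>carrier = a_rcosets\<^bsub>M\<^esub> W, mult = undefined, one = undefined,
      zero = W, add = set_add M,
      smult = (\<lambda>c X. \<Union>x\<in>X. W +>\<^bsub>M\<^esub> (c \<odot>\<^bsub>M\<^esub> x))\<rparr>"

abbreviation code_quotient :: "nat \<Rightarrow> 'e :: field vec set \<Rightarrow> 'e vec set \<Rightarrow> ('e, 'e vec set) module" where
  "code_quotient n C1 C2 \<equiv> quotient_module ((module_vec TYPE('e) n)\<lparr>carrier := C1\<rparr>) C2"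

definition coset_encoder ::
    "nat \<Rightarrow> nat \<Rightarrow> 'e :: field vec set \<Rightarrow> 'e vec set \<Rightarrow> ('e vec \<Rightarrow> 'e vec set) \<Rightarrow> bool" where
  "coset_encoder n l C1 C2 \<psi> \<longleftrightarrow>
     \<psi> \<in> LinearCombinations.module_hom class_ring (module_vec TYPE('e) l) (code_quotient n C1 C2) \<and>
     bij_betw \<psi> (carrier_vec l) (carrier (code_quotient n C1 C2))"

definition frobenius_image :: "nat \<Rightarrow> 'e :: field vec set \<Rightarrow> 'e vec set" where
  "frobenius_image q V = map_vec (\<lambda>x. x ^ q) ` V"

definition frobenius_stable_subspaces :: "nat \<Rightarrow> nat \<Rightarrow> 'e :: field vec set set" where
  "frobenius_stable_subspaces q n = {V. linear_code n V \<and> V = frobenius_image q V}"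

definition relative_rank_weight1 ::
    "nat \<Rightarrow> nat \<Rightarrow> 'e :: field vec set \<Rightarrow> 'e vec set \<Rightarrow> nat" where
  "relative_rank_weight1 q n C1 C2 =
     Min {subspace_dim n V | V. V \<in> frobenius_stable_subspaces q n \<and>
            int (subspace_dim n (C1 \<inter> V)) - int (subspace_dim n (C2 \<inter> V)) \<ge> 1}"

definition lift_vec :: "('e \<Rightarrow> 'k :: field vec) \<Rightarrow> nat \<Rightarrow> nat \<Rightarrow> 'e vec \<Rightarrow> 'k mat" where
  "lift_vec \<phi> r n x = 1\<^sub>m n @\<^sub>r mat_of_cols r (map \<phi> (list_of_vec x))"

definition lifted_packets ::
    "('e \<Rightarrow> 'k :: field vec) \<Rightarrow> nat \<Rightarrow> nat \<Rightarrow> ('e vec \<Rightarrow> 'e vec set) \<Rightarrow> 'e vec \<Rightarrow> 'k mat set" where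
  "lifted_packets \<phi> r n \<psi> S = lift_vec \<phi> r n ` \<psi> S"

definition transfer_matrices :: "nat \<Rightarrow> nat \<Rightarrow> nat \<Rightarrow> 'k :: field mat set" where
  "transfer_matrices N n \<rho> = {A \<in> carrier_mat N n. vec_space.rank N A \<ge> n - \<rho>}"

text \<open>
  \<open>\<X> S\<close> is the set of \<open>m \<times> n\<close> matrices that may encode the message \<open>S\<close> of length \<open>l\<close>.
\<close>

definition noncoherent_universally_correcting ::
    "nat \<Rightarrow> nat \<Rightarrow> nat \<Rightarrow> nat \<Rightarrow> nat \<Rightarrow> nat \<Rightarrow> ('e vec \<Rightarrow> 'k :: field mat set) \<Rightarrow> bool" where
  "noncoherent_universally_correcting t \<rho> N m n l \<X> \<longleftrightarrow>
     \<not> (\<exists>S \<in> carrier_vec l. \<exists>S' \<in> carrier_vec l. S \<noteq> S' \<and>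
         (\<exists>X \<in> \<X> S. \<exists>X' \<in> \<X> S'.
          \<exists>A \<in> transfer_matrices N n \<rho>. \<exists>A' \<in> transfer_matrices N n \<rho>.
          \<exists>D \<in> carrier_mat N t. \<exists>D' \<in> carrier_mat N t.
          \<exists>Z \<in> carrier_mat m t. \<exists>Z' \<in> carrier_mat m t.
            A * transpose_mat X + D * transpose_mat Z =
            A' * transpose_mat X' + D' * transpose_mat Z'))"

end

theory Submission
  imports Defs
begin

text \<open>
  Write \<open>M c\<close> for the \<open>n \<times> r\<close> matrix over the small field with rows \<open>\<phi> (c $ i)\<close>, where \<open>r = m - n\<close>. By
  Galois descent, a Frobenius-stable subspace of dimension \<open>d\<close> is spanned by \<open>d\<close> vectors over the
  small field, and such a subspace contains \<open>c\<close> for some \<open>d \<le> D\<close> iff \<open>M c\<close> has rank at most \<open>D\<close>.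
  So the relative weight is the least rank of \<open>M c\<close> for \<open>c \<in> C1 - C2\<close>.

  Codewords \<open>x\<close> and \<open>x'\<close> of different messages can collide iff the rank of \<open>A * M (x - x')\<close> is at most
  \<open>2 * t\<close> for some transfer matrix \<open>A\<close>: multiplying the two received matrices from the right by a matrix that
  annihilates the packet of \<open>x'\<close> eliminates the second transfer matrix. Since \<open>A\<close> has a kernel of
  dimension at most \<open>\<rho>\<close>, and any \<open>\<rho>\<close> vectors lie in the kernel of some \<open>A\<close>, this is
  possible iff the rank of \<open>M (x - x')\<close> is at most \<open>2 * t + \<rho>\<close>. Ranks are compared through cardinalities.
\<close>

section \<open>Dimension and rank over finite fields\<close>

lemma linear_code_iff:
  "linear_code n (V :: 'e :: field vec set) \<longleftrightarrow>
     V \<subseteq> carrier_vec n \<and> 0\<^sub>v n \<in> V \<and> (\<forall>u\<in>V. \<forall>v\<in>V. u + v \<in> V) \<and> (\<forall>c. \<forall>v\<in>V. c \<cdot>\<^sub>v v \<in> V)"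
  using vec_vs[where 'a = 'e and n = n] vec_module[where 'a = 'e and n = n]
  by (auto simp: VectorSpace.subspace_def submodule_def module_vec_simps class_ring_simps)

lemma linear_code_diff:
  assumes "linear_code n (V :: 'e :: field vec set)" "u \<in> V" "v \<in> V"
  shows "u - v \<in> V"
proof -
  have "u + (- 1) \<cdot>\<^sub>v v \<in> V" "u \<in> carrier_vec n" "v \<in> carrier_vec n"
    using assms unfolding linear_code_iff by auto
  moreover from this have "u + (- 1) \<cdot>\<^sub>v v = u - v" by (intro eq_vecI) auto
  ultimately show ?thesis by simp
qed

lemma finite_carrier_vec [simp]: "finite (carrier_vec n :: 'a :: finite vec set)"
  and card_carrier_vec: "card (carrier_vec n :: 'a :: finite vec set) = CARD('a) ^ n"
proof -
  have b: "bij_betw vec_of_list {xs :: 'a list. set xs \<subseteq> UNIV \<and> length xs = n} (carrier_vec n)"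
    unfolding carrier_vec_def
    by (rule bij_betw_byWitness[where f' = list_of_vec]) (auto simp: vec_list list_vec image_subset_iff)
  have "finite {xs :: 'a list. set xs \<subseteq> UNIV \<and> length xs = n}"
    by (rule finite_lists_length_eq) simp
  then show "finite (carrier_vec n :: 'a vec set)" using bij_betw_finite[OF b] by blast
  show "card (carrier_vec n :: 'a vec set) = CARD('a) ^ n"
    using bij_betw_same_card[OF b] card_lists_length_eq[of "UNIV :: 'a set" n] by simp
qed

text \<open>The column space, taken as an image so that statements about ranks become statements
  about the size of a finite set.\<close>

definition mat_range :: "'a :: semiring_0 mat \<Rightarrow> 'a vec set" where
  "mat_range A = (*\<^sub>v) A ` carrier_vec (dim_col A)"

lemma mat_range_eq: "A \<in> carrier_mat nr nc \<Longrightarrow> mat_range A = (*\<^sub>v) A ` carrier_vec nc"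
  by (simp add: mat_range_def)

lemma linear_code_mat_range:
  fixes A :: "'a :: field mat"
  assumes A: "A \<in> carrier_mat n d"
  shows "linear_code n (mat_range A)"
  unfolding linear_code_iff mat_range_eq[OF A]
proof (intro conjI ballI allI)
  show "(*\<^sub>v) A ` carrier_vec d \<subseteq> carrier_vec n" using A by auto
  show "0\<^sub>v n \<in> (*\<^sub>v) A ` carrier_vec d"
    by (rule image_eqI[of _ _ "0\<^sub>v d"]) (use A in auto)
  fix u assume "u \<in> (*\<^sub>v) A ` carrier_vec d"
  then obtain x where x: "x \<in> carrier_vec d" "u = A *\<^sub>v x" by auto
  show "c \<cdot>\<^sub>v u \<in> (*\<^sub>v) A ` carrier_vec d" for c
    by (rule image_eqI[of _ _ "c \<cdot>\<^sub>v x"]) (use A x mult_mat_vec[OF A] in auto)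
  fix v assume "v \<in> (*\<^sub>v) A ` carrier_vec d"
  then obtain y where y: "y \<in> carrier_vec d" "v = A *\<^sub>v y" by auto
  show "u + v \<in> (*\<^sub>v) A ` carrier_vec d"
    by (rule image_eqI[of _ _ "x + y"]) (use A x y mult_add_distrib_mat_vec[OF A] in auto)
qed

text \<open>A maximal independent subset of \<open>S\<close> supplies the columns of
  \<open>P\<close>. That the columns stay inside \<open>S\<close> matters for descent, where
  \<open>S\<close> consists of vectors with entries in the subfield; injectivity makes
  \<open>P\<close> a coordinate system.\<close>

lemma (in vec_space) basis_matrix_of_span:
  assumes S: "S \<subseteq> carrier_vec n" "finite S"
  shows "\<exists>P \<in> carrier_mat n (subspace_dim n (span S)).
           set (cols P) \<subseteq> S \<and> mat_range P = span S \<and> inj_on ((*\<^sub>v) P) (carrier_vec (dim_col P))"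
proof -
  obtain U where max: "maximal U (\<lambda>T. T \<subseteq> S \<and> lin_indpt T)"
  proof -
    have "lin_indpt {}" by (auto simp: lin_dep_def)
    then show ?thesis
      using maximal_exists_superset[OF S(2), of "\<lambda>T. T \<subseteq> S \<and> lin_indpt T" "{}"] that by blast
  qed
  have U: "U \<subseteq> S" "lin_indpt U" using max by (auto simp: maximal_def)
  have finU: "finite U" using U S finite_subset by blast
  have Uc: "U \<subseteq> carrier_vec n" using U S by blast
  have "s \<in> span U" if "s \<in> S" for s
  proof (rule ccontr)
    assume s: "s \<notin> span U"
    then have "s \<notin> U" using in_own_span[of U] Uc by auto
    moreover have "lin_indpt (U \<union> {s})"
      using s U Uc S that lin_dep_iff_in_span[of U s] \<open>s \<notin> U\<close> by auto
    moreover have "U \<union> {s} \<subseteq> S" using that U(1) by simp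
    ultimately show False using max unfolding maximal_def by blast
  qed
  then have "span S \<subseteq> span U" using span_subsetI[OF Uc] by blast
  then have span: "span U = span S" using span_is_monotone[OF U(1)] by blast
  have dim: "subspace_dim n (span S) = card U"
    unfolding subspace_dim_def using dim_span[OF _ S(2) max] S by simp
  obtain us where us: "set us = U" "distinct us" using finite_distinct_list[OF finU] by blast
  define P where "P = mat_of_cols n us"
  have len: "length us = card U" using distinct_card[OF us(2)] us(1) by simp
  have P: "P \<in> carrier_mat n (card U)" unfolding P_def len[symmetric] by simp
  have cols: "cols P = us" using Uc us by (simp add: P_def)
  have usc: "set us \<subseteq> carrier_vec n" using Uc us by simp
  \<comment> \<open>\<open>lincomb\<close> takes its coefficients as a function on vectors; the
    enumeration \<open>us\<close> turns them into a coefficient vector.\<close>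
  have lc: "P *\<^sub>v vec (length us) (\<lambda>i. f (us ! i)) = lincomb f U" for f
  proof -
    have "lincomb f U = lincomb_list (\<lambda>i. f (us ! i)) us"
      using lincomb_as_lincomb_list_distinct[OF usc us(2)] us by simp
    also have "\<dots> = P *\<^sub>v vec (length us) (\<lambda>i. f (us ! i))"
      unfolding P_def using usc by (intro lincomb_list_as_mat_mult) auto
    finally show ?thesis by simp
  qed
  have rep: "\<exists>f. x = vec (length us) (\<lambda>i. f (us ! i))" if "x \<in> carrier_vec (length us)" for x
  proof
    \<comment> \<open>Distinctness of \<open>us\<close> makes the position of a vector unique, so
      every coefficient vector comes from a function on vectors.\<close>
    show "x = vec (length us) (\<lambda>i. (\<lambda>u. x $ (THE j. j < length us \<and> us ! j = u)) (us ! i))"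
    proof (rule eq_vecI)
      fix i assume "i < dim_vec (vec (length us) (\<lambda>i. (\<lambda>u. x $ (THE j. j < length us \<and> us ! j = u)) (us ! i)))"
      then have i: "i < length us" by simp
      have "(THE j. j < length us \<and> us ! j = us ! i) = i"
        using i us(2) by (intro the_equality) (auto simp: nth_eq_iff_index_eq)
      then show "x $ i = vec (length us) (\<lambda>i. (\<lambda>u. x $ (THE j. j < length us \<and> us ! j = u)) (us ! i)) $ i"
        using i by simp
    qed (use that in auto)
  qed
  have "mat_range P = {lincomb f U | f. True}"
    unfolding mat_range_eq[OF P] len[symmetric] using rep lc by (auto simp: image_iff) (metis vec_carrier)
  also have "\<dots> = span U" using finite_span[OF finU] Uc by auto
  finally have ran: "mat_range P = span S" using span by simp
  have inj: "inj_on ((*\<^sub>v) P) (carrier_vec (dim_col P))"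
  proof (rule inj_onI)
    fix x y assume x: "x \<in> carrier_vec (dim_col P)" and y: "y \<in> carrier_vec (dim_col P)"
      and eq: "P *\<^sub>v x = P *\<^sub>v y"
    \<comment> \<open>The difference of two coefficient vectors with the same image gives a
      vanishing combination of independent columns.\<close>
    have c: "x - y \<in> carrier_vec (length us)" using x y P len by auto
    then obtain f where f: "x - y = vec (length us) (\<lambda>i. f (us ! i))" using rep by blast
    have "P *\<^sub>v (x - y) = 0\<^sub>v n"
      using mult_minus_distrib_mat_vec[OF P, of x y] x y eq P by auto
    then have "lincomb f U = 0\<^sub>v n" using lc f by metis
    then have "f u = 0" if "u \<in> U" for u
      using U(2) that finU unfolding lin_dep_def by auto
    then have "x - y = 0\<^sub>v (length us)" unfolding f using us by (intro eq_vecI) auto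
    then have "x $ i - y $ i = 0" if "i < length us" for i
      using x y P len that by (metis carrier_matD(2) carrier_vecD index_minus_vec(1) index_zero_vec(1))
    then show "x = y" using x y P len by (intro eq_vecI) auto
  qed
  show ?thesis unfolding dim using P U(1) us(1) ran inj cols by (intro bexI[of _ P]) auto
qed

lemma span_linear_code:
  assumes "linear_code n (V :: 'e :: field vec set)"
  shows "LinearCombinations.module.span class_ring (module_vec TYPE('e) n) V = V"
proof -
  interpret vec_space "TYPE('e)" n .
  have "V \<subseteq> carrier_vec n" using assms by (simp add: linear_code_iff)
  moreover have "submodule class_ring V (module_vec TYPE('e) n)" using assms by (simp add: VectorSpace.subspace_def)
  ultimately show ?thesis using span_is_subset[of V V] in_own_span[of V] by auto
qed

lemma basis_matrix:
  fixes V :: "'e :: {field, finite} vec set"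
  assumes V: "linear_code n V"
  obtains P where "P \<in> carrier_mat n (subspace_dim n V)" "mat_range P = V"
    "inj_on ((*\<^sub>v) P) (carrier_vec (subspace_dim n V))"
proof -
  interpret vec_space "TYPE('e)" n .
  have Vc: "V \<subseteq> carrier_vec n" using V by (simp add: linear_code_iff)
  obtain P where "P \<in> carrier_mat n (subspace_dim n (span V))" "mat_range P = span V"
    "inj_on ((*\<^sub>v) P) (carrier_vec (dim_col P))"
    using basis_matrix_of_span[OF Vc finite_subset[OF Vc finite_carrier_vec]] by blast
  then show ?thesis using that[of P] by (simp add: span_linear_code[OF V])
qed

text \<open>A basis matrix maps coefficient vectors bijectively onto the code. From here on
  dimensions are compared by counting.\<close>

lemma card_linear_code:
  fixes V :: "'e :: {field, finite} vec set"
  assumes V: "linear_code n V"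
  shows "card V = CARD('e) ^ subspace_dim n V"
proof -
  obtain P where P: "P \<in> carrier_mat n (subspace_dim n V)" "mat_range P = V"
    and inj: "inj_on ((*\<^sub>v) P) (carrier_vec (subspace_dim n V))"
    by (rule basis_matrix[OF V])
  have "card V = card ((*\<^sub>v) P ` carrier_vec (subspace_dim n V))"
    using P by (simp add: mat_range_eq)
  then show ?thesis by (simp add: card_image[OF inj] card_carrier_vec)
qed

lemma card_field_gt_1: "1 < CARD('e :: {field, finite})"
proof -
  have "card {0, 1 :: 'e} \<le> CARD('e)" by (rule card_mono) auto
  then show ?thesis by simp
qed

lemma subspace_dim_le_iff:
  fixes V :: "'e :: {field, finite} vec set"
  assumes "linear_code n V"
  shows "subspace_dim n V \<le> d \<longleftrightarrow> card V \<le> CARD('e) ^ d"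
  using card_field_gt_1[where 'e = 'e] by (simp add: card_linear_code[OF assms])

lemma subspace_dim_less_iff:
  fixes V W :: "'e :: {field, finite} vec set"
  assumes "linear_code n V" "linear_code n W"
  shows "subspace_dim n V < subspace_dim n W \<longleftrightarrow> card V < card W"
  using card_field_gt_1[where 'e = 'e]
  by (simp add: card_linear_code[OF assms(1)] card_linear_code[OF assms(2)])

section \<open>Ranks as sizes of column spaces\<close>

lemma rank_eq_dim_mat_range:
  fixes A :: "'e :: field mat"
  assumes A: "A \<in> carrier_mat n nc"
  shows "vec_space.rank n A = subspace_dim n (mat_range A)"
proof -
  interpret vec_space "TYPE('e)" n .
  have "span (set (cols A)) = mat_range A"
    using col_space_eq[OF A] A unfolding col_space_def mat_range_eq[OF A] by auto
  then show ?thesis by (simp add: rank_def subspace_dim_def)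
qed

lemma rank_ge_iff:
  fixes A :: "'e :: {field, finite} mat"
  assumes A: "A \<in> carrier_mat n nc"
  shows "r \<le> vec_space.rank n A \<longleftrightarrow> CARD('e) ^ r \<le> card (mat_range A)"
  using card_field_gt_1[where 'e = 'e]
  by (simp add: rank_eq_dim_mat_range[OF A] card_linear_code[OF linear_code_mat_range[OF A]])

lemma finite_linear_code: "linear_code n (V :: 'e :: {field, finite} vec set) \<Longrightarrow> finite V"
  unfolding linear_code_iff using finite_subset[OF _ finite_carrier_vec] by blast

text \<open>Rank-nullity in counting form: the nonempty fibres of \<open>A\<close> on
  \<open>U\<close> are translates of the kernel of \<open>A\<close> in \<open>U\<close>.\<close>

lemma card_linear_code_image_kernel:
  fixes U :: "'e :: {field, finite} vec set"
  assumes U: "linear_code n U" and A: "A \<in> carrier_mat N n"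
  shows "card U = card ((*\<^sub>v) A ` U) * card {u \<in> U. A *\<^sub>v u = 0\<^sub>v N}"
proof -
  have Uc: "u \<in> carrier_vec n" if "u \<in> U" for u using U that by (auto simp: linear_code_iff)
  have fib: "card {u \<in> U. A *\<^sub>v u = y} = card {u \<in> U. A *\<^sub>v u = 0\<^sub>v N}"
    if y: "y \<in> (*\<^sub>v) A ` U" for y
  proof -
    obtain s where s: "s \<in> U" "y = A *\<^sub>v s" using y by blast
    have "bij_betw (\<lambda>u. u - s) {u \<in> U. A *\<^sub>v u = y} {u \<in> U. A *\<^sub>v u = 0\<^sub>v N}"
    proof (rule bij_betw_byWitness[where f' = "\<lambda>u. u + s"])
      show "\<forall>u\<in>{u \<in> U. A *\<^sub>v u = y}. u - s + s = u"
        and "\<forall>u\<in>{u \<in> U. A *\<^sub>v u = 0\<^sub>v N}. u + s - s = u"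
        using carrier_vecD[OF Uc[OF s(1)]] carrier_vecD[OF Uc] by (auto intro!: eq_vecI)
      show "(\<lambda>u. u - s) ` {u \<in> U. A *\<^sub>v u = y} \<subseteq> {u \<in> U. A *\<^sub>v u = 0\<^sub>v N}"
        using s linear_code_diff[OF U] Uc A by (auto simp: mult_minus_distrib_mat_vec[OF A])
      show "(\<lambda>u. u + s) ` {u \<in> U. A *\<^sub>v u = 0\<^sub>v N} \<subseteq> {u \<in> U. A *\<^sub>v u = y}"
        using s U Uc A by (auto simp: mult_add_distrib_mat_vec[OF A] linear_code_iff)
    qed
    then show ?thesis by (rule bij_betw_same_card)
  qed
  have "card U = (\<Sum>y\<in>(*\<^sub>v) A ` U. card {u \<in> U. A *\<^sub>v u = y})"
    unfolding card_eq_sum by (rule sum.image_gen[OF finite_linear_code[OF U]])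
  also have "\<dots> = card ((*\<^sub>v) A ` U) * card {u \<in> U. A *\<^sub>v u = 0\<^sub>v N}"
    using fib by simp
  finally show ?thesis .
qed

lemma mat_range_mult:
  fixes G K :: "'e :: field mat"
  assumes G: "G \<in> carrier_mat n d" and K: "K \<in> carrier_mat d p"
  shows "mat_range (G * K) = (*\<^sub>v) G ` mat_range K"
  unfolding mat_range_eq[OF K] mat_range_eq[OF mult_carrier_mat[OF G K]] image_image
  using assms by (intro image_cong) auto

lemma mat_range_mult_subset:
  fixes G K :: "'e :: field mat"
  assumes "G \<in> carrier_mat n d" "K \<in> carrier_mat d p"
  shows "mat_range (G * K) \<subseteq> mat_range G"
  using assms mat_range_eq[OF assms(1)] mat_range_eq[OF mult_carrier_mat[OF assms]] by auto

lemma card_mat_range_le: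
  fixes G :: "'e :: {field, finite} mat"
  assumes "G \<in> carrier_mat n d"
  shows "card (mat_range G) \<le> CARD('e) ^ d"
  using card_image_le[of "carrier_vec d" "(*\<^sub>v) G"]
  by (simp add: mat_range_eq[OF assms] card_carrier_vec)

text \<open>Every column of \<open>A\<close> is a combination of a basis of the column space, and
  \<open>K\<close> collects the coefficients. \<open>D\<close> need only bound the rank, so the
  inner dimension can be prescribed.\<close>

lemma rank_factorization:
  fixes A :: "'e :: {field, finite} mat"
  assumes A: "A \<in> carrier_mat n p" and card: "card (mat_range A) \<le> CARD('e) ^ D"
  obtains G K where "G \<in> carrier_mat n D" "K \<in> carrier_mat D p" "A = G * K"
proof -
  define d where "d = subspace_dim n (mat_range A)"
  have V: "linear_code n (mat_range A)" by (rule linear_code_mat_range[OF A])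
  have d: "d \<le> D" using card by (simp add: subspace_dim_le_iff[OF V] d_def)
  obtain P where P: "P \<in> carrier_mat n d" "mat_range P = mat_range A"
    unfolding d_def by (rule basis_matrix[OF V])
  have "\<exists>k. k \<in> carrier_vec d \<and> P *\<^sub>v k = col A j" if j: "j < p" for j
  proof -
    have "col A j = A *\<^sub>v unit_vec p j" using A j by (intro eq_vecI) auto
    then have "col A j \<in> mat_range P" using j by (auto simp: P(2) mat_range_eq[OF A])
    then show ?thesis by (auto simp: mat_range_eq[OF P(1)])
  qed
  then obtain k where k: "\<And>j. j < p \<Longrightarrow> k j \<in> carrier_vec d \<and> P *\<^sub>v k j = col A j" by metis
  \<comment> \<open>Zero columns in \<open>G\<close> and zero rows in \<open>K\<close> pad the inner
    dimension from \<open>d\<close> to \<open>D\<close>.\<close>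
  define G where "G = mat n D (\<lambda>(i, j). if j < d then P $$ (i, j) else 0)"
  define K where "K = mat D p (\<lambda>(i, j). if i < d then k j $ i else 0)"
  have "A = G * K"
  proof (rule eq_matI)
    fix i j assume "i < dim_row (G * K)" "j < dim_col (G * K)"
    then have i: "i < n" and j: "j < p" by (auto simp: G_def K_def)
    have "(G * K) $$ (i, j) = (\<Sum>l<D. G $$ (i, l) * K $$ (l, j))"
      using i j by (simp add: G_def K_def scalar_prod_def lessThan_atLeast0)
    also have "\<dots> = (\<Sum>l<d. P $$ (i, l) * k j $ l)"
      by (rule sum.mono_neutral_cong_right) (use i j d in \<open>auto simp: G_def K_def\<close>)
    also have "\<dots> = (P *\<^sub>v k j) $ i"
      using P(1) conjunct1[OF k[OF j]] i by (auto simp: scalar_prod_def lessThan_atLeast0)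
    also have "\<dots> = A $$ (i, j)" using k[OF j] A i j by simp
    finally show "A $$ (i, j) = (G * K) $$ (i, j)" by simp
  qed (use A in \<open>auto simp: G_def K_def\<close>)
  then show ?thesis using that[of G K] by (simp add: G_def K_def)
qed

text \<open>Factor \<open>A = G * K\<close> with inner dimension equal to the rank: the columns of
  \<open>A\<^sup>T\<close> then lie in the column space of \<open>K\<^sup>T\<close>, which has only
  \<open>d\<close> columns.\<close>

lemma card_mat_range_transpose_le:
  fixes A :: "'e :: {field, finite} mat"
  assumes A: "A \<in> carrier_mat n p"
  shows "card (mat_range A\<^sup>T) \<le> card (mat_range A)"
proof -
  define d where "d = subspace_dim n (mat_range A)"
  have V: "linear_code n (mat_range A)" by (rule linear_code_mat_range[OF A])
  have c: "card (mat_range A) = CARD('e) ^ d" unfolding d_def by (rule card_linear_code[OF V])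
  then obtain G K where GK: "G \<in> carrier_mat n d" "K \<in> carrier_mat d p" "A = G * K"
    using rank_factorization[OF A, of d] by auto
  have "mat_range A\<^sup>T \<subseteq> mat_range K\<^sup>T"
    using GK by (simp add: transpose_mult[OF GK(1,2)]) (rule mat_range_mult_subset, auto)
  moreover have "finite (mat_range K\<^sup>T)"
    using finite_linear_code[OF linear_code_mat_range, of "K\<^sup>T"] GK by blast
  ultimately have "card (mat_range A\<^sup>T) \<le> card (mat_range K\<^sup>T)" by (rule card_mono[rotated])
  also have "\<dots> \<le> CARD('e) ^ d" using card_mat_range_le[of "K\<^sup>T" p d] GK by simp
  finally show ?thesis using c by simp
qed

section \<open>Galois descent\<close>

text \<open>Multiplication by a nonzero \<open>x\<close> permutes the nonzero elements. Comparing
  their product before and after shows that \<open>x ^ (CARD('a) - 1)\<close> is 1.\<close>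

lemma power_card_field:
  fixes x :: "'a :: {field, finite}"
  shows "x ^ CARD('a) = x"
proof (cases "x = 0")
  case True
  then show ?thesis by simp
next
  case False
  let ?S = "UNIV - {0 :: 'a}"
  have "bij_betw ((*) x) ?S ?S"
    using False by (intro bij_betw_byWitness[where f' = "\<lambda>y. y / x"]) auto
  then have "(\<Prod>y\<in>?S. x * y) = \<Prod>?S" by (rule prod.reindex_bij_betw)
  then have "x ^ card ?S * \<Prod>?S = 1 * \<Prod>?S" by (simp add: prod.distrib)
  then have "x ^ (CARD('a) - 1) = 1" by simp
  then have "x ^ (CARD('a) - 1) * x = x" by (metis mult_1)
  then show ?thesis using power_minus_mult[of "CARD('a)" x] by (metis zero_less_card_finite)
qed

text \<open>
  The polynomial \<open>(X + 1) ^ q - X ^ q - 1\<close> vanishes on the field with \<open>q\<close> elements and has degree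
  less than \<open>q\<close>, so its coefficients are zero.
\<close>

lemma of_nat_binomial_card_eq_0:
  assumes "0 < i" "i < CARD('a :: {field, finite})"
  shows "of_nat (CARD('a) choose i) = (0 :: 'a)"
proof -
  let ?q = "CARD('a)"
  define p where "p = [:1, 1 :: 'a:] ^ ?q - monom 1 ?q - 1"
  have deg: "degree ([:1, 1 :: 'a:] ^ ?q) = ?q" by (rule degree_linear_power)
  have "p = 0"
  proof (rule ccontr)
    assume "p \<noteq> 0"
    then have "card {x. poly p x = 0} \<le> degree p" by (rule card_poly_roots_bound)
    moreover have "{x. poly p x = 0} = UNIV"
      by (simp add: p_def poly_monom power_card_field)
    \<comment> \<open>Both powers are monic of degree \<open>?q\<close>, so their leading terms
      cancel.\<close>
    moreover have "coeff p j = 0" if "j > ?q - 1" for j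
    proof (cases "j = ?q")
      case True
      then show ?thesis by (simp add: p_def coeff_linear_power)
    next
      case False
      then have "?q < j" using that by linarith
      then show ?thesis using deg by (simp add: p_def coeff_eq_0)
    qed
    then have "degree p \<le> ?q - 1" by (intro degree_le) simp
    moreover have "0 < ?q" by simp
    ultimately show False by (metis Suc_n_not_le_n Suc_pred' diff_Suc_1 order_trans)
  qed
  then have "coeff p i = 0" by simp
  then show ?thesis
    using assms coeff_linear_poly_power[of i ?q 1 "1 :: 'a"] by (simp add: p_def)
qed

context
  fixes emb :: "'k :: {field, finite} \<Rightarrow> 'e :: {field, finite}"
  assumes emb: "field_hom emb"
begin

interpretation emb: field_hom emb by (rule emb)

text \<open>The inner binomial coefficients vanish in the small field, and \<open>emb\<close>
  carries this to the extension.\<close>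

lemma power_card_subfield_add:
  fixes x y :: 'e
  shows "(x + y) ^ CARD('k) = x ^ CARD('k) + y ^ CARD('k)"
proof -
  let ?q = "CARD('k)" and ?f = "\<lambda>i. of_nat (CARD('k) choose i) * x ^ i * y ^ (CARD('k) - i)"
  have "of_nat (?q choose i) = (0 :: 'e)" if "0 < i" "i < ?q" for i
    using arg_cong[OF of_nat_binomial_card_eq_0[OF that], of emb] by (simp add: emb.hom_of_nat)
  then have "sum ?f {..?q} = sum ?f {0, ?q}"
    by (intro sum.mono_neutral_right) (auto simp: le_less)
  then show ?thesis by (simp add: binomial_ring)
qed

text \<open>The polynomial with terms \<open>X ^ q\<close> and \<open>- X\<close> has at most
  \<open>q\<close> roots, and the image of the small field already supplies \<open>q\<close> of
  them.\<close>

lemma in_range_iff_power_card: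
  fixes x :: 'e
  shows "x \<in> range emb \<longleftrightarrow> x ^ CARD('k) = x"
proof -
  define p :: "'e poly" where "p = monom 1 CARD('k) - monom 1 1"
  have q: "1 < CARD('k)" by (rule card_field_gt_1)
  have "coeff p CARD('k) = 1" using q by (simp add: p_def)
  then have p0: "p \<noteq> 0" by auto
  have "degree p \<le> CARD('k)" using q by (auto simp: p_def intro!: degree_diff_le degree_monom_le[THEN order_trans])
  then have "card {x. poly p x = 0} \<le> CARD('k)" using card_poly_roots_bound[OF p0] by simp
  moreover have "card (range emb) = CARD('k)" by (rule card_image) (rule emb.inj_f)
  moreover have "range emb \<subseteq> {x. poly p x = 0}"
    by (auto simp: p_def poly_monom power_card_field simp flip: emb.hom_power)
  ultimately have "range emb = {x. poly p x = 0}" by (intro card_seteq) auto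
  then show ?thesis by (auto simp: p_def poly_monom)
qed

text \<open>
  Galois descent. For \<open>v\<close> with an entry equal to 1, the difference of \<open>v\<close> and its Frobenius image
  has smaller support. If \<open>v\<close> is scaled to make either of two entries equal to 1 whose ratio is not
  in the subfield, then the two differences have \<open>v\<close> in their span.
\<close>

lemma frobenius_stable_subset_span:
  fixes V :: "'e vec set"
  assumes V: "linear_code n V" and stable: "frobenius_image CARD('k) V \<subseteq> V"
  shows "V \<subseteq> LinearCombinations.module.span class_ring (module_vec TYPE('e) n)
                 {v \<in> V. \<forall>i<n. v $ i \<in> range emb}"
proof -
  interpret vec_space "TYPE('e)" n .
  let ?V0 = "{v \<in> V. \<forall>i<n. v $ i \<in> range emb}"
  let ?F = "map_vec (\<lambda>x :: 'e. x ^ CARD('k))"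
  have Vc: "v \<in> carrier_vec n" if "v \<in> V" for v using V that by (auto simp: linear_code_iff)
  have V0c: "?V0 \<subseteq> carrier_vec n" using Vc by blast
  have F: "?F v \<in> V" if "v \<in> V" for v using stable that by (auto simp: frobenius_image_def)
  have W: "linear_code n (span ?V0)" using span_is_subspace[of ?V0] V0c by simp
  have smultW: "c \<cdot>\<^sub>v v \<in> span ?V0" if "v \<in> span ?V0" for c v using W that by (auto simp: linear_code_iff)
  have smultV: "c \<cdot>\<^sub>v v \<in> V" if "v \<in> V" for c v using V that by (auto simp: linear_code_iff)
  have "v \<in> span ?V0" if "v \<in> V" for v
    using that
  proof (induction "card {i. i < n \<and> v $ i \<noteq> 0}" arbitrary: v rule: less_induct)
    case less
    note vc = Vc[OF less.prems]
    have step: "?F (c \<cdot>\<^sub>v v) - c \<cdot>\<^sub>v v \<in> span ?V0" if j: "j < n" and c: "c * v $ j = 1" for c j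
    proof (rule less.hyps)
      have "{i. i < n \<and> (?F (c \<cdot>\<^sub>v v) - c \<cdot>\<^sub>v v) $ i \<noteq> 0} \<subseteq> {i. i < n \<and> v $ i \<noteq> 0}"
        using vc by (auto simp: power_0_left)
      moreover have "j \<notin> {i. i < n \<and> (?F (c \<cdot>\<^sub>v v) - c \<cdot>\<^sub>v v) $ i \<noteq> 0}" using vc j c by auto
      moreover have "j \<in> {i. i < n \<and> v $ i \<noteq> 0}" using j c by auto
      ultimately have "{i. i < n \<and> (?F (c \<cdot>\<^sub>v v) - c \<cdot>\<^sub>v v) $ i \<noteq> 0} \<subset> {i. i < n \<and> v $ i \<noteq> 0}"
        by blast
      then show "card {i. i < n \<and> (?F (c \<cdot>\<^sub>v v) - c \<cdot>\<^sub>v v) $ i \<noteq> 0} < card {i. i < n \<and> v $ i \<noteq> 0}"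
        by (rule psubset_card_mono[rotated]) simp
      show "?F (c \<cdot>\<^sub>v v) - c \<cdot>\<^sub>v v \<in> V"
        using linear_code_diff[OF V] F smultV less.prems by blast
    qed
    show "v \<in> span ?V0"
    proof (cases "\<exists>j<n. v $ j \<noteq> 0")
      case False
      then have "v = 0\<^sub>v n" using vc by (intro eq_vecI) auto
      then show ?thesis using W by (simp add: linear_code_iff)
    next
      case True
      then obtain j where j: "j < n" "v $ j \<noteq> 0" by blast
      define u where "u = inverse (v $ j) \<cdot>\<^sub>v v"
      have u: "u \<in> V" unfolding u_def by (rule smultV[OF less.prems])
      have vu: "v = v $ j \<cdot>\<^sub>v u" using j vc by (simp add: u_def smult_smult_assoc)
      have "u \<in> span ?V0"
      proof (cases "\<forall>i<n. u $ i \<in> range emb")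
        case True
        then show ?thesis using u in_own_span[of ?V0] V0c by auto
      next
        case False
        then obtain i where i: "i < n" "u $ i \<notin> range emb" by blast
        \<comment> \<open>The vector \<open>u\<close> has entry 1 at \<open>j\<close>; scaling by
          \<open>b\<close> produces an entry 1 at \<open>i\<close> instead.\<close>
        define b where "b = inverse (u $ i)"
        have "u $ i \<noteq> 0" using i(2) emb.hom_zero by (metis rangeI)
        then have b: "b * u $ i = 1" by (simp add: b_def)
        have "b \<notin> range emb"
        proof
          assume "b \<in> range emb"
          then obtain k where "b = emb k" by blast
          then have "u $ i = emb (inverse k)" by (simp add: b_def emb.hom_inverse) (metis inverse_inverse_eq)
          then show False using i(2) by blast
        qed
        then have bq: "b - b ^ CARD('k) \<noteq> 0" by (auto simp: in_range_iff_power_card)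
        have d1: "?F u - u \<in> span ?V0"
          using step[OF j(1), of "inverse (v $ j)"] j(2) by (simp add: u_def)
        have "?F (b \<cdot>\<^sub>v u) - b \<cdot>\<^sub>v u \<in> span ?V0"
          using step[OF i(1), of "b * inverse (v $ j)"] b i(1) vc
          by (simp add: u_def smult_smult_assoc mult.assoc)
        \<comment> \<open>Scaling \<open>u\<close> by \<open>b\<close> scales its Frobenius image by
          \<open>b ^ CARD('k)\<close>. Hence this combination cancels the image and leaves
          \<open>u\<close> times a scalar that is nonzero because \<open>b\<close> is outside the
          subfield.\<close>
        then have "b ^ CARD('k) \<cdot>\<^sub>v (?F u - u) - (?F (b \<cdot>\<^sub>v u) - b \<cdot>\<^sub>v u) \<in> span ?V0"
          using linear_code_diff[OF W smultW[OF d1]] by blast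
        also have "b ^ CARD('k) \<cdot>\<^sub>v (?F u - u) - (?F (b \<cdot>\<^sub>v u) - b \<cdot>\<^sub>v u) = (b - b ^ CARD('k)) \<cdot>\<^sub>v u"
          using Vc[OF u] by (intro eq_vecI) (auto simp: algebra_simps power_mult_distrib)
        finally have "inverse (b - b ^ CARD('k)) \<cdot>\<^sub>v ((b - b ^ CARD('k)) \<cdot>\<^sub>v u) \<in> span ?V0"
          by (rule smultW)
        then show ?thesis using bq by (simp add: smult_smult_assoc)
      qed
      then have "v $ j \<cdot>\<^sub>v u \<in> span ?V0" by (rule smultW)
      then show ?thesis unfolding vu[symmetric] .
    qed
  qed
  then show ?thesis by blast
qed

section \<open>Frobenius-stable subspaces as column spaces over the small field\<close>

text \<open>By descent the vectors with subfield entries span \<open>V\<close>. A basis drawn from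
  them is the image under \<open>emb\<close> of a matrix over the small field, with as many columns
  as the dimension of \<open>V\<close> over the extension.\<close>

lemma frobenius_stable_imp_mat_range:
  fixes V :: "'e vec set"
  assumes "V \<in> frobenius_stable_subspaces CARD('k) n"
  obtains G where "G \<in> carrier_mat n (subspace_dim n V)" "V = mat_range (map_mat emb G)"
proof -
  interpret vec_space "TYPE('e)" n .
  let ?V0 = "{v \<in> V. \<forall>i<n. v $ i \<in> range emb}"
  have V: "linear_code n V" and "frobenius_image CARD('k) V \<subseteq> V"
    using assms by (auto simp: frobenius_stable_subspaces_def)
  then have "V \<subseteq> span ?V0" by (intro frobenius_stable_subset_span)
  moreover have "span ?V0 \<subseteq> span V" by (rule span_is_monotone) blast
  ultimately have span: "span ?V0 = V" using span_linear_code[OF V] by blast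
  have Vc: "V \<subseteq> carrier_vec n" using V by (simp add: linear_code_iff)
  have "?V0 \<subseteq> carrier_vec n" "finite ?V0" using Vc finite_linear_code[OF V] by auto
  from basis_matrix_of_span[OF this]
  obtain P where P: "P \<in> carrier_mat n (subspace_dim n V)" "set (cols P) \<subseteq> ?V0" "mat_range P = V"
    unfolding span by blast
  have "P $$ (i, j) \<in> range emb" if "i < dim_row P" "j < dim_col P" for i j
  proof -
    have "col P j \<in> set (cols P)" using that by (simp add: cols_def)
    then show ?thesis using P(1,2) that by (auto dest!: subsetD)
  qed
  then have eq: "map_mat emb (map_mat (inv_into UNIV emb) P) = P" by (intro eq_matI) (auto simp: f_inv_into_f)
  show ?thesis
  proof (rule that[of "map_mat (inv_into UNIV emb) P"])
    show "map_mat (inv_into UNIV emb) P \<in> carrier_mat n (subspace_dim n V)" using P(1) by simp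
    show "V = mat_range (map_mat emb (map_mat (inv_into UNIV emb) P))" unfolding eq P(3) ..
  qed
qed

text \<open>The Frobenius map is additive and multiplicative and fixes the entries of
  \<open>map_mat emb G\<close>, so it commutes with this matrix.\<close>

lemma mat_range_frobenius_stable:
  fixes G :: "'k mat"
  assumes G: "G \<in> carrier_mat n d"
  shows "mat_range (map_mat emb G) \<in> frobenius_stable_subspaces CARD('k) n"
proof -
  let ?G = "map_mat emb G" and ?F = "map_vec (\<lambda>x :: 'e. x ^ CARD('k))"
  have E: "?G \<in> carrier_mat n d" using G by simp
  have sum_pow: "(\<Sum>i\<in>I. f i) ^ CARD('k) = (\<Sum>i\<in>I. f i ^ CARD('k))" if "finite I" for f :: "nat \<Rightarrow> 'e" and I
    using that by (induction rule: finite_induct) (auto simp: power_card_subfield_add power_0_left)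
  have F: "?F (?G *\<^sub>v x) = ?G *\<^sub>v ?F x" if x: "x \<in> carrier_vec d" for x
  proof (rule eq_vecI)
    fix i assume "i < dim_vec (?G *\<^sub>v ?F x)"
    then have i: "i < n" using G by simp
    have "emb k ^ CARD('k) = emb k" for k using in_range_iff_power_card[of "emb k"] by simp
    then show "?F (?G *\<^sub>v x) $ i = (?G *\<^sub>v ?F x) $ i"
      using G x i by (simp add: scalar_prod_def sum_pow power_mult_distrib)
  qed simp
  \<comment> \<open>Stability demands equality and not only inclusion: an injective self-map of the
    finite set of coefficient vectors is onto.\<close>
  have Fsurj: "?F ` carrier_vec d = carrier_vec d"
  proof (rule endo_inj_surj)
    \<comment> \<open>Additivity gives \<open>(x - y) ^ CARD('k) = 0\<close>.\<close>
    have inj: "x = y" if "x ^ CARD('k) = y ^ CARD('k)" for x y :: 'e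
      using that power_card_subfield_add[of "x - y" y] by simp
    show "inj_on ?F (carrier_vec d)"
    proof (rule inj_onI)
      fix x y :: "'e vec"
      assume xy: "x \<in> carrier_vec d" "y \<in> carrier_vec d" and "?F x = ?F y"
      with xy have "x $ i ^ CARD('k) = y $ i ^ CARD('k)" if "i < d" for i
        using that by (metis index_map_vec(1) carrier_vecD)
      then have "x $ i = y $ i" if "i < d" for i using that by (blast intro: inj)
      with xy show "x = y" by (intro eq_vecI) auto
    qed
  qed auto
  have "frobenius_image CARD('k) (mat_range ?G) = (\<lambda>x. ?G *\<^sub>v ?F x) ` carrier_vec d"
    unfolding frobenius_image_def mat_range_eq[OF E] image_image using F by (intro image_cong) auto
  also have "\<dots> = (*\<^sub>v) ?G ` (?F ` carrier_vec d)" by (simp add: image_image)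
  finally have "frobenius_image CARD('k) (mat_range ?G) = mat_range ?G"
    unfolding Fsurj mat_range_eq[OF E] .
  then show ?thesis using linear_code_mat_range[OF E] by (simp add: frobenius_stable_subspaces_def)
qed

end

section \<open>Relative weight and transfer matrices\<close>

lemma mat_range_map_mat_mult_subset:
  assumes "field_hom emb" and "G \<in> carrier_mat n d" "K \<in> carrier_mat d p"
  shows "mat_range (map_mat emb (G * K)) \<subseteq> mat_range (map_mat emb G)"
proof -
  interpret emb: field_hom emb by (rule assms(1))
  show ?thesis
    unfolding emb.mat_hom_mult[OF assms(2,3)] using assms(2,3) by (intro mat_range_mult_subset) auto
qed

section \<open>The relative weight as a minimum over codewords\<close>

lemma finite_frobenius_stable_subspaces: "finite (frobenius_stable_subspaces q n :: 'e :: {field, finite} vec set set)"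
proof (rule finite_subset)
  show "frobenius_stable_subspaces q n \<subseteq> Pow (carrier_vec n :: 'e vec set)"
    unfolding frobenius_stable_subspaces_def linear_code_iff by blast
qed simp

text \<open>A stable \<open>V\<close> is admissible exactly when it meets \<open>C1 - C2\<close>,
  and by descent the stable subspaces of dimension at most \<open>D\<close> are the column spaces of
  \<open>n\<close> by \<open>D\<close> matrices over the small field.\<close>

lemma relative_rank_weight1_le_iff:
  fixes emb :: "'k :: {field, finite} \<Rightarrow> 'e :: {field, finite}"
  assumes emb: "field_hom emb"
    and C1: "linear_code n C1" and C2: "linear_code n C2" and sub: "C2 \<subset> C1"
  shows "relative_rank_weight1 CARD('k) n C1 C2 \<le> D \<longleftrightarrow>
           (\<exists>c \<in> C1 - C2. \<exists>G \<in> carrier_mat n D. c \<in> mat_range (map_mat emb G))"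
proof -
  let ?\<Gamma> = "{V \<in> frobenius_stable_subspaces CARD('k) n. V \<inter> (C1 - C2) \<noteq> {}}"
  have dim: "int (subspace_dim n (C1 \<inter> V)) - int (subspace_dim n (C2 \<inter> V)) \<ge> 1 \<longleftrightarrow> V \<inter> (C1 - C2) \<noteq> {}"
    if "V \<in> frobenius_stable_subspaces CARD('k) n" for V
  proof -
    have "linear_code n (C1 \<inter> V)" "linear_code n (C2 \<inter> V)"
      using that C1 C2 by (auto simp: frobenius_stable_subspaces_def linear_code_iff)
    note less = subspace_dim_less_iff[OF this(2,1)] and fin = finite_linear_code[OF this(1)]
    have le: "C2 \<inter> V \<subseteq> C1 \<inter> V" using sub by blast
    \<comment> \<open>One intersection contains the other, so a strict difference in dimension is
      the same as inequality of the two sets.\<close>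
    have "card (C2 \<inter> V) < card (C1 \<inter> V) \<longleftrightarrow> C2 \<inter> V \<noteq> C1 \<inter> V"
      using psubset_card_mono[OF fin, of "C2 \<inter> V"] le by (metis less_irrefl psubsetI)
    also have "\<dots> \<longleftrightarrow> V \<inter> (C1 - C2) \<noteq> {}" using sub by blast
    finally show ?thesis using less by linarith
  qed
  have "{subspace_dim n V | V. V \<in> frobenius_stable_subspaces CARD('k) n \<and>
            int (subspace_dim n (C1 \<inter> V)) - int (subspace_dim n (C2 \<inter> V)) \<ge> 1} = subspace_dim n ` ?\<Gamma>"
    using dim by blast
  then have w: "relative_rank_weight1 CARD('k) n C1 C2 = Min (subspace_dim n ` ?\<Gamma>)"
    by (simp add: relative_rank_weight1_def)
  have fin: "finite (subspace_dim n ` ?\<Gamma>)" 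
    by (intro finite_imageI finite_subset[OF _ finite_frobenius_stable_subspaces[of "CARD('k)" n]]) blast
  have one: "1\<^sub>m n \<in> carrier_mat n n" by simp
  have "mat_range (map_mat emb (1\<^sub>m n)) = carrier_vec n"
  proof -
    interpret emb: field_hom emb by (rule emb)
    show ?thesis by (simp add: mat_range_def emb.mat_hom_one)
  qed
  \<comment> \<open>The whole space is admissible, so the minimum is taken over a nonempty
    set.\<close>
  then have "carrier_vec n \<in> ?\<Gamma>"
    using mat_range_frobenius_stable[OF emb one] sub C1 by (auto simp: linear_code_iff)
  then have ne: "subspace_dim n ` ?\<Gamma> \<noteq> {}" by blast
  show ?thesis
    unfolding w
  proof
    assume "Min (subspace_dim n ` ?\<Gamma>) \<le> D"
    moreover obtain V where "V \<in> ?\<Gamma>" "Min (subspace_dim n ` ?\<Gamma>) = subspace_dim n V"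
      using Min_in[OF fin ne] by blast
    ultimately have V: "V \<in> ?\<Gamma>" "subspace_dim n V \<le> D" by simp_all
    then obtain G where G: "G \<in> carrier_mat n (subspace_dim n V)" "V = mat_range (map_mat emb G)"
      using frobenius_stable_imp_mat_range[OF emb] by blast
    have "card (mat_range G) \<le> CARD('k) ^ D"
      using card_mat_range_le[OF G(1)] power_increasing[OF V(2), of "CARD('k)"] by (metis One_nat_def Suc_leI le_trans zero_less_card_finite)
    then obtain G' K where "G' \<in> carrier_mat n D" "K \<in> carrier_mat D (subspace_dim n V)" "G = G' * K"
      by (rule rank_factorization[OF G(1)])
    then show "\<exists>c \<in> C1 - C2. \<exists>G \<in> carrier_mat n D. c \<in> mat_range (map_mat emb G)"
      using mat_range_map_mat_mult_subset[OF emb, of G' n D K] V(1) G(2) by blast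
  next
    assume "\<exists>c \<in> C1 - C2. \<exists>G \<in> carrier_mat n D. c \<in> mat_range (map_mat emb G)"
    then obtain c G where c: "c \<in> C1 - C2" and G: "G \<in> carrier_mat n D" "c \<in> mat_range (map_mat emb G)"
      by blast
    have E: "map_mat emb G \<in> carrier_mat n D" using G by simp
    have "mat_range (map_mat emb G) \<in> ?\<Gamma>" using mat_range_frobenius_stable[OF emb G(1)] c G(2) by blast
    moreover have "subspace_dim n (mat_range (map_mat emb G)) \<le> D"
      unfolding subspace_dim_le_iff[OF linear_code_mat_range[OF E]] by (rule card_mat_range_le[OF E])
    ultimately show "Min (subspace_dim n ` ?\<Gamma>) \<le> D" using Min_le[OF fin] by (meson imageI order_trans)
  qed
qed

section \<open>Transfer matrices with a prescribed kernel\<close>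

lemma card_mat_range_truncated_identity:
  assumes "r \<le> a" "r \<le> b"
  shows "CARD('k) ^ r \<le> card (mat_range (mat a b (\<lambda>(i, j). if i = j then 1 else 0 :: 'k :: {field, finite})))"
    (is "_ \<le> card (mat_range ?E)")
proof -
  have E: "?E \<in> carrier_mat a b" by simp
  \<comment> \<open>Pad a vector of length \<open>r\<close> with zeros to length \<open>b\<close>;
    its entries reappear as the first \<open>r\<close> entries of the product, so the map is
    injective.\<close>
  let ?f = "\<lambda>v :: 'k vec. ?E *\<^sub>v vec b (\<lambda>i. if i < r then v $ i else 0)"
  have f: "?f v $ i = v $ i" if "i < r" for v i
    using that assms by (simp add: scalar_prod_def if_distrib[of "\<lambda>x. x * _"] cong: if_cong)
  have "inj_on ?f (carrier_vec r)"
  proof (rule inj_onI)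
    fix v w assume vw: "v \<in> carrier_vec r" "w \<in> carrier_vec r" and eq: "?f v = ?f w"
    have "v $ i = w $ i" if "i < r" for i using f[OF that, of v] f[OF that, of w] eq by simp
    then show "v = w" using vw by (intro eq_vecI) auto
  qed
  moreover have "?f ` carrier_vec r \<subseteq> mat_range ?E" by (auto simp: mat_range_eq[OF E])
  moreover have "finite (mat_range ?E)" by (rule finite_linear_code[OF linear_code_mat_range[OF E]])
  ultimately show ?thesis using card_inj_on_le[of ?f "carrier_vec r" "mat_range ?E"] by (simp add: card_carrier_vec)
qed

lemma card_kernel_mult_card_mat_range:
  fixes A :: "'k :: {field, finite} mat"
  assumes A: "A \<in> carrier_mat N n"
  shows "card (mat_range A) * card {v \<in> carrier_vec n. A *\<^sub>v v = 0\<^sub>v N} = CARD('k) ^ n"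
proof -
  have "linear_code n (carrier_vec n :: 'k vec set)" by (auto simp: linear_code_iff)
  from card_linear_code_image_kernel[OF this A] show ?thesis
    by (simp add: card_carrier_vec mat_range_eq[OF A])
qed

lemma zero_mult_mat_vec:
  "v \<in> carrier_vec nc \<Longrightarrow> 0\<^sub>m nr nc *\<^sub>v v = (0\<^sub>v nr :: 'a :: semiring_0 vec)"
  by (intro eq_vecI) (auto simp: scalar_prod_def)

text \<open>The rows of \<open>A\<close> come from the left kernel \<open>L\<close> of
  \<open>G\<close>. Since \<open>G\<close> has \<open>\<rho>\<close> columns, rank-nullity gives
  \<open>L\<close> dimension at least \<open>n - \<rho>\<close>, which leaves enough independent
  rows for a transfer matrix.\<close>

lemma transfer_matrix_annihilating:
  fixes G :: "'k :: {field, finite} mat"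
  assumes G: "G \<in> carrier_mat n \<rho>" and \<rho>: "\<rho> \<le> n" and N: "n - \<rho> \<le> N"
  obtains A where "A \<in> transfer_matrices N n \<rho>" "A * G = 0\<^sub>m N \<rho>"
proof -
  define L where "L = {v \<in> carrier_vec n. G\<^sup>T *\<^sub>v v = 0\<^sub>v \<rho>}"
  have GT: "G\<^sup>T \<in> carrier_mat \<rho> n" using G by simp
  have L: "linear_code n L"
    unfolding linear_code_iff L_def using GT
    by (auto simp: mult_add_distrib_mat_vec[OF GT] mult_mat_vec[OF GT])
  have "card (mat_range G\<^sup>T) \<le> CARD('k) ^ \<rho>"
    using card_mono[of "carrier_vec \<rho>" "mat_range G\<^sup>T"] linear_code_mat_range[OF GT]
    by (simp add: card_carrier_vec linear_code_iff)
  then have "CARD('k) ^ n \<le> CARD('k) ^ \<rho> * card L"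
    using card_kernel_mult_card_mat_range[OF GT] unfolding L_def by (metis mult_le_mono1)
  then have "CARD('k) ^ \<rho> * CARD('k) ^ (n - \<rho>) \<le> CARD('k) ^ \<rho> * card L"
    using \<rho> by (simp flip: power_add)
  then have "CARD('k) ^ (n - \<rho>) \<le> CARD('k) ^ subspace_dim n L"
    by (simp add: card_linear_code[OF L])
  then have d: "n - \<rho> \<le> subspace_dim n L" using card_field_gt_1[where 'e = 'k] by simp
  let ?d = "subspace_dim n L"
  obtain P where P: "P \<in> carrier_mat n ?d" "mat_range P = L" "inj_on ((*\<^sub>v) P) (carrier_vec ?d)"
    by (rule basis_matrix[OF L])
  \<comment> \<open>\<open>P * E\<close> keeps leading columns of \<open>P\<close> and adds zero
    columns if \<open>N\<close> exceeds \<open>?d\<close>. As \<open>n - \<rho>\<close> is at most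
    \<open>?d\<close> and at most \<open>N\<close>, enough independent columns survive.\<close>
  define E where "E = mat ?d N (\<lambda>(i, j). if i = j then 1 else 0 :: 'k)"
  have E: "E \<in> carrier_mat ?d N" by (simp add: E_def)
  define A where "A = (P * E)\<^sup>T"
  have A: "A \<in> carrier_mat N n" using P(1) E by (simp add: A_def)
  have "mat_range (P * E) = (*\<^sub>v) P ` mat_range E"
    by (rule mat_range_mult[OF P(1) E])
  moreover have "mat_range E \<subseteq> carrier_vec ?d" using linear_code_mat_range[OF E] by (simp add: linear_code_iff)
  ultimately have "card (mat_range (P * E)) = card (mat_range E)"
    using card_image[OF inj_on_subset[OF P(3)]] by simp
  then have "CARD('k) ^ (n - \<rho>) \<le> card (mat_range (P * E))"
    using card_mat_range_truncated_identity[OF d N] by (simp add: E_def)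
  \<comment> \<open>The columns of \<open>P * E\<close> are the rows of \<open>A\<close>, so row
    rank has to be traded for column rank.\<close>
  also have "\<dots> \<le> card (mat_range A)" using card_mat_range_transpose_le[OF A] by (simp add: A_def)
  finally have "A \<in> transfer_matrices N n \<rho>" using A by (simp add: transfer_matrices_def rank_ge_iff[OF A])
  moreover have "A * G = 0\<^sub>m N \<rho>"
  proof -
    have "G\<^sup>T * P = 0\<^sub>m \<rho> ?d"
    proof (rule eq_matI)
      fix i j assume "i < dim_row (0\<^sub>m \<rho> ?d :: 'k mat)" "j < dim_col (0\<^sub>m \<rho> ?d :: 'k mat)"
      then have i: "i < \<rho>" and j: "j < ?d" by auto
      have "col P j = P *\<^sub>v unit_vec ?d j" using P(1) j by (intro eq_vecI) auto
      then have "col P j \<in> mat_range P" unfolding mat_range_eq[OF P(1)] by simp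
      then have "col P j \<in> L" using P(2) by blast
      then have "(G\<^sup>T *\<^sub>v col P j) $ i = 0" using i by (simp add: L_def)
      then show "(G\<^sup>T * P) $$ (i, j) = 0\<^sub>m \<rho> ?d $$ (i, j)" using i j G P(1) by simp
    qed (use G P(1) in auto)
    then have "G\<^sup>T * (P * E) = 0\<^sub>m \<rho> N"
      using assoc_mult_mat[OF GT P(1) E] E by simp
    then have "(G\<^sup>T * (P * E))\<^sup>T = 0\<^sub>m N \<rho>" by simp
    then show ?thesis using transpose_mult[OF GT mult_carrier_mat[OF P(1) E]] by (simp add: A_def)
  qed
  ultimately show ?thesis by (rule that)
qed

text \<open>Forwards, the kernel of \<open>A\<close> has at most \<open>CARD('k) ^ \<rho>\<close>
  elements, so passing from \<open>M\<close> to \<open>A * M\<close> loses at most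
  \<open>\<rho>\<close> in rank. Backwards, factor \<open>M\<close> through dimension
  \<open>s + \<rho>\<close> and choose \<open>A\<close> to annihilate \<open>\<rho>\<close> columns
  of the left factor.\<close>

lemma exists_transfer_matrix_iff:
  fixes M :: "'k :: {field, finite} mat"
  assumes M: "M \<in> carrier_mat n r" and \<rho>: "\<rho> \<le> n" and N: "n - \<rho> \<le> N"
  shows "(\<exists>A \<in> transfer_matrices N n \<rho>. card (mat_range (A * M)) \<le> CARD('k) ^ s) \<longleftrightarrow>
           card (mat_range M) \<le> CARD('k) ^ (s + \<rho>)"
proof
  assume "\<exists>A \<in> transfer_matrices N n \<rho>. card (mat_range (A * M)) \<le> CARD('k) ^ s"
  then obtain A where A: "A \<in> carrier_mat N n" and rk: "CARD('k) ^ (n - \<rho>) \<le> card (mat_range A)"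
    and s: "card (mat_range (A * M)) \<le> CARD('k) ^ s"
    by (auto simp: transfer_matrices_def rank_ge_iff)
  let ?ker = "{v \<in> carrier_vec n. A *\<^sub>v v = 0\<^sub>v N}"
  have "CARD('k) ^ (n - \<rho>) * card ?ker \<le> CARD('k) ^ n"
    using mult_le_mono1[OF rk] unfolding card_kernel_mult_card_mat_range[OF A, symmetric] .
  also have "\<dots> = CARD('k) ^ (n - \<rho>) * CARD('k) ^ \<rho>" using \<rho> by (simp flip: power_add)
  finally have ker: "card ?ker \<le> CARD('k) ^ \<rho>" by simp
  have U: "linear_code n (mat_range M)" by (rule linear_code_mat_range[OF M])
  have "card (mat_range M) = card ((*\<^sub>v) A ` mat_range M) * card {u \<in> mat_range M. A *\<^sub>v u = 0\<^sub>v N}"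
    by (rule card_linear_code_image_kernel[OF U A])
  also have "(*\<^sub>v) A ` mat_range M = mat_range (A * M)"
    by (rule mat_range_mult[OF A M, symmetric])
  also have "card {u \<in> mat_range M. A *\<^sub>v u = 0\<^sub>v N} \<le> card ?ker"
    using U by (intro card_mono) (auto simp: linear_code_iff)
  finally have "card (mat_range M) \<le> card (mat_range (A * M)) * card ?ker" by simp
  also have "\<dots> \<le> CARD('k) ^ s * CARD('k) ^ \<rho>" by (rule mult_le_mono[OF s ker])
  finally show "card (mat_range M) \<le> CARD('k) ^ (s + \<rho>)" by (simp add: power_add)
next
  assume "card (mat_range M) \<le> CARD('k) ^ (s + \<rho>)"
  then obtain G K where G: "G \<in> carrier_mat n (s + \<rho>)" and K: "K \<in> carrier_mat (s + \<rho>) r" and GK: "M = G * K"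
    by (rule rank_factorization[OF M])
  \<comment> \<open>\<open>G * E\<close> consists of the first \<open>\<rho>\<close> columns of
    \<open>G\<close>; once \<open>A\<close> annihilates them, the kernel of \<open>A * G\<close>
    contains the column space of \<open>E\<close>.\<close>
  define E where "E = mat (s + \<rho>) \<rho> (\<lambda>(i, j). if i = j then 1 else 0 :: 'k)"
  have E: "E \<in> carrier_mat (s + \<rho>) \<rho>" by (simp add: E_def)
  obtain A where A: "A \<in> transfer_matrices N n \<rho>" "A * (G * E) = 0\<^sub>m N \<rho>"
    by (rule transfer_matrix_annihilating[OF mult_carrier_mat[OF G E] \<rho> N])
  have Ac: "A \<in> carrier_mat N n" using A(1) by (simp add: transfer_matrices_def)
  have AG: "A * G \<in> carrier_mat N (s + \<rho>)" using Ac G by simp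
  have "(A * G) * E = 0\<^sub>m N \<rho>" using A(2) assoc_mult_mat[OF Ac G E] by simp
  then have "(A * G) *\<^sub>v (E *\<^sub>v v) = 0\<^sub>v N" if "v \<in> carrier_vec \<rho>" for v
    using assoc_mult_mat_vec[OF AG E that] that by (metis zero_mult_mat_vec)
  then have "mat_range E \<subseteq> {v \<in> carrier_vec (s + \<rho>). (A * G) *\<^sub>v v = 0\<^sub>v N}"
    using E by (auto simp: mat_range_eq[OF E])
  then have "card (mat_range E) \<le> card {v \<in> carrier_vec (s + \<rho>). (A * G) *\<^sub>v v = 0\<^sub>v N}"
    by (intro card_mono) auto
  moreover have "CARD('k) ^ \<rho> \<le> card (mat_range E)"
    unfolding E_def by (rule card_mat_range_truncated_identity) auto
  ultimately have "card (mat_range (A * G)) * CARD('k) ^ \<rho> \<le> CARD('k) ^ (s + \<rho>)"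
    unfolding card_kernel_mult_card_mat_range[OF AG, symmetric] by simp
  then have "card (mat_range (A * G)) \<le> CARD('k) ^ s" by (simp add: power_add)
  moreover have "card (mat_range (A * M)) \<le> card (mat_range (A * G))"
  proof (rule card_mono)
    show "finite (mat_range (A * G))" by (rule finite_linear_code[OF linear_code_mat_range[OF AG]])
    show "mat_range (A * M) \<subseteq> mat_range (A * G)"
      unfolding GK assoc_mult_mat[OF Ac G K, symmetric] by (rule mat_range_mult_subset[OF AG K])
  qed
  ultimately show "\<exists>A \<in> transfer_matrices N n \<rho>. card (mat_range (A * M)) \<le> CARD('k) ^ s"
    using A(1) order_trans by blast
qed

section \<open>Collisions of lifted packets\<close>

lemma carrier_code_quotient:
  "carrier (code_quotient n C1 C2) = (\<lambda>x. (\<lambda>w. w + x) ` C2) ` C1"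
  by (auto simp: quotient_module_def A_RCOSETS_def' a_r_coset_def' module_vec_simps)

text \<open>Distinct messages have distinct cosets, while a difference in \<open>C2\<close> would
  make the two cosets equal.\<close>

lemma coset_encoder_diff:
  assumes enc: "coset_encoder n l C1 C2 \<psi>"
    and C1: "linear_code n (C1 :: 'e :: field vec set)" and C2: "linear_code n C2" and sub: "C2 \<subset> C1"
    and S: "S \<in> carrier_vec l" "S' \<in> carrier_vec l" "S \<noteq> S'" and x: "x \<in> \<psi> S" "x' \<in> \<psi> S'"
  shows "x \<in> C1" "x' \<in> C1" "x - x' \<in> C1 - C2"
proof -
  have bij: "bij_betw \<psi> (carrier_vec l) ((\<lambda>x. (\<lambda>w. w + x) ` C2) ` C1)"
    using enc by (simp add: coset_encoder_def carrier_code_quotient)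
  have ne: "\<psi> S \<noteq> \<psi> S'" using bij S by (metis bij_betw_imp_inj_on inj_on_def)
  have mem: "\<psi> S \<in> (\<lambda>x. (\<lambda>w. w + x) ` C2) ` C1" "\<psi> S' \<in> (\<lambda>x. (\<lambda>w. w + x) ` C2) ` C1"
    using bij_betwE[OF bij] S(1,2) by blast+
  obtain y where y: "\<psi> S = (\<lambda>w. w + y) ` C2" "y \<in> C1" by (rule imageE[OF mem(1)])
  obtain y' where y': "\<psi> S' = (\<lambda>w. w + y') ` C2" "y' \<in> C1" by (rule imageE[OF mem(2)])
  obtain w w' where w: "w \<in> C2" "x = w + y" and w': "w' \<in> C2" "x' = w' + y'"
    using x unfolding y(1) y'(1) by blast
  have C2c: "v \<in> carrier_vec n" if "v \<in> C2" for v using C2 that by (auto simp: linear_code_iff)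
  have C1c: "v \<in> carrier_vec n" if "v \<in> C1" for v using C1 that by (auto simp: linear_code_iff)
  have C2a: "u + v \<in> C2" if "u \<in> C2" "v \<in> C2" for u v using C2 that by (auto simp: linear_code_iff)
  show xx: "x \<in> C1" "x' \<in> C1"
    using C1 sub w y(2) w' y'(2) by (auto simp: linear_code_iff)
  have "x - x' \<notin> C2"
  proof
    assume d: "x - x' \<in> C2"
    note c = carrier_vecD[OF C2c[OF w(1)]] carrier_vecD[OF C2c[OF w'(1)]]
      carrier_vecD[OF C1c[OF y(2)]] carrier_vecD[OF C1c[OF y'(2)]]
    \<comment> \<open>Because \<open>y - y' = - w + (x - x') + w'\<close>, each element of one coset
      is rewritten as an element of the other.\<close>
    have "v + y = (v - w + (x - x') + w') + y'" if "v \<in> C2" for v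
      using c carrier_vecD[OF C2c[OF that]] by (intro eq_vecI) (auto simp: w(2) w'(2))
    moreover have "v + y' = (v - w' - (x - x') + w) + y" if "v \<in> C2" for v
      using c carrier_vecD[OF C2c[OF that]] by (intro eq_vecI) (auto simp: w(2) w'(2))
    moreover have "v - w + (x - x') + w' \<in> C2" "v - w' - (x - x') + w \<in> C2" if "v \<in> C2" for v
      using that w w' d by (auto intro!: C2a linear_code_diff[OF C2])
    ultimately have "\<psi> S = \<psi> S'" unfolding y(1) y'(1) by blast
    then show False using ne by simp
  qed
  then show "x - x' \<in> C1 - C2" using linear_code_diff[OF C1 xx] by simp
qed

text \<open>Used to build a collision between \<open>c\<close> and the zero codeword, so that every
  element of \<open>C1 - C2\<close> occurs as a difference of codewords of distinct
  messages.\<close>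

lemma coset_encoder_separates:
  assumes enc: "coset_encoder n l C1 C2 \<psi>"
    and C1: "linear_code n (C1 :: 'e :: field vec set)" and C2: "linear_code n C2" and sub: "C2 \<subset> C1"
    and c: "c \<in> C1 - C2"
  obtains S S' where "S \<in> carrier_vec l" "S' \<in> carrier_vec l" "S \<noteq> S'" "c \<in> \<psi> S" "0\<^sub>v n \<in> \<psi> S'"
proof -
  have surj: "\<psi> ` carrier_vec l = (\<lambda>x. (\<lambda>w. w + x) ` C2) ` C1"
    using enc by (simp add: coset_encoder_def carrier_code_quotient bij_betw_imp_surj_on)
  have C2c: "v \<in> carrier_vec n" if "v \<in> C2" for v using C2 that by (auto simp: linear_code_iff)
  have cc: "c \<in> carrier_vec n" using C1 c by (auto simp: linear_code_iff)
  have z: "0\<^sub>v n \<in> C1" "0\<^sub>v n \<in> C2" using C1 C2 by (auto simp: linear_code_iff)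
  have mem: "(\<lambda>w. w + x) ` C2 \<in> \<psi> ` carrier_vec l" if "x \<in> C1" for x
    unfolding surj using that by (rule imageI)
  obtain S where S: "(\<lambda>w. w + c) ` C2 = \<psi> S" "S \<in> carrier_vec l"
    by (rule imageE[OF mem]) (use c in auto)
  obtain S' where S': "(\<lambda>w. w + 0\<^sub>v n) ` C2 = \<psi> S'" "S' \<in> carrier_vec l"
    by (rule imageE[OF mem[OF z(1)]])
  \<comment> \<open>The coset of zero is \<open>C2\<close> itself, which does not contain
    \<open>c\<close>; hence the two messages differ.\<close>
  have "(\<lambda>w. w + 0\<^sub>v n) ` C2 = C2" using C2c by (auto simp: image_iff)
  moreover have "c \<in> \<psi> S" unfolding S(1)[symmetric] using z(2) cc by (intro image_eqI[of _ _ "0\<^sub>v n"]) auto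
  ultimately show ?thesis using that[of S S'] S S' z c by auto
qed

section \<open>Coordinate matrices over the small field\<close>

text \<open>This is the transpose of the lower block of a lifted packet, so that transfer matrices
  act on it from the left.\<close>

definition coord_matrix :: "('e \<Rightarrow> 'k vec) \<Rightarrow> nat \<Rightarrow> 'e vec \<Rightarrow> 'k mat" where
  "coord_matrix \<phi> r x = mat (dim_vec x) r (\<lambda>(i, j). \<phi> (x $ i) $ j)"

lemma coord_matrix_carrier [simp]: "x \<in> carrier_vec n \<Longrightarrow> coord_matrix \<phi> r x \<in> carrier_mat n r"
  by (simp add: coord_matrix_def)

lemma transpose_append_rows_mult_vec:
  fixes A B :: "'a :: comm_semiring_0 mat"
  assumes A: "A \<in> carrier_mat nr1 nc" and B: "B \<in> carrier_mat nr2 nc"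
    and a: "a \<in> carrier_vec nr1" and b: "b \<in> carrier_vec nr2"
  shows "(A @\<^sub>r B)\<^sup>T *\<^sub>v (a @\<^sub>v b) = A\<^sup>T *\<^sub>v a + B\<^sup>T *\<^sub>v b"
proof (rule eq_vecI)
  fix i assume "i < dim_vec (A\<^sup>T *\<^sub>v a + B\<^sup>T *\<^sub>v b)"
  then have i: "i < nc" using B by simp
  have "col (A @\<^sub>r B) i = col A i @\<^sub>v col B i"
    using A B i by (intro eq_vecI) (auto simp: append_rows_def)
  then have "((A @\<^sub>r B)\<^sup>T *\<^sub>v (a @\<^sub>v b)) $ i = (col A i @\<^sub>v col B i) \<bullet> (a @\<^sub>v b)"
    using A B i by (simp add: append_rows_def)
  also have "\<dots> = col A i \<bullet> a + col B i \<bullet> b"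
    using A B a b i by (intro scalar_prod_append) auto
  finally show "((A @\<^sub>r B)\<^sup>T *\<^sub>v (a @\<^sub>v b)) $ i = (A\<^sup>T *\<^sub>v a + B\<^sup>T *\<^sub>v b) $ i"
    using A B i by simp
qed (use A B in \<open>auto simp: append_rows_def\<close>)

lemma lift_vec_eq:
  assumes "x \<in> carrier_vec n" and "\<And>y. \<phi> y \<in> carrier_vec r"
  shows "lift_vec \<phi> r n x = 1\<^sub>m n @\<^sub>r (coord_matrix \<phi> r x)\<^sup>T"
proof -
  have "mat_of_cols r (map \<phi> (list_of_vec x)) = (coord_matrix \<phi> r x)\<^sup>T"
    using assms(1) by (intro eq_matI) (auto simp: mat_of_cols_index coord_matrix_def list_of_vec_index)
  then show ?thesis by (simp add: lift_vec_def)
qed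

lemma eq_matI_mult_vec:
  fixes A B :: "'a :: comm_semiring_1 mat"
  assumes A: "A \<in> carrier_mat nr nc" and B: "B \<in> carrier_mat nr nc"
    and eq: "\<And>v. v \<in> carrier_vec nc \<Longrightarrow> A *\<^sub>v v = B *\<^sub>v v"
  shows "A = B"
proof (rule eq_matI)
  fix i j assume "i < dim_row B" "j < dim_col B"
  then have ij: "i < nr" "j < nc" using B by auto
  have "(A *\<^sub>v unit_vec nc j) $ i = (B *\<^sub>v unit_vec nc j) $ i" using eq by simp
  then show "A $$ (i, j) = B $$ (i, j)" using A B ij by simp
qed (use A B in auto)

lemma append_rows_cases:
  fixes K :: "'a :: zero mat"
  assumes K: "K \<in> carrier_mat (s + t) p"
  obtains K1 K2 where "K1 \<in> carrier_mat s p" "K2 \<in> carrier_mat t p" "K = K1 @\<^sub>r K2"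
proof (rule that)
  show "K = mat s p (\<lambda>(i, j). K $$ (i, j)) @\<^sub>r mat t p (\<lambda>(i, j). K $$ (i + s, j))"
    using K by (intro eq_matI) (auto simp: append_rows_def)
qed auto

text \<open>A rank bound \<open>s + t\<close> is divided between two products, one for each of two
  error terms: the left factor is cut into two blocks of columns and the right factor into two
  blocks of rows.\<close>

lemma rank_factorization_split:
  fixes A :: "'k :: {field, finite} mat"
  assumes A: "A \<in> carrier_mat n p" and card: "card (mat_range A) \<le> CARD('k) ^ (s + t)"
  obtains G1 G2 K1 K2 where "G1 \<in> carrier_mat n s" "G2 \<in> carrier_mat n t"
    "K1 \<in> carrier_mat s p" "K2 \<in> carrier_mat t p"
    "\<And>v. v \<in> carrier_vec p \<Longrightarrow> A *\<^sub>v v = G1 *\<^sub>v (K1 *\<^sub>v v) + G2 *\<^sub>v (K2 *\<^sub>v v)"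
proof -
  obtain G K where G: "G \<in> carrier_mat n (s + t)" and K: "K \<in> carrier_mat (s + t) p" and GK: "A = G * K"
    by (rule rank_factorization[OF A card])
  obtain K1 K2 where K12: "K1 \<in> carrier_mat s p" "K2 \<in> carrier_mat t p" "K = K1 @\<^sub>r K2"
    by (rule append_rows_cases[OF K])
  have "G\<^sup>T \<in> carrier_mat (s + t) n" using G by simp
  then obtain H1 H2 where H: "H1 \<in> carrier_mat s n" "H2 \<in> carrier_mat t n" "G\<^sup>T = H1 @\<^sub>r H2"
    by (rule append_rows_cases)
  have G': "G = (H1 @\<^sub>r H2)\<^sup>T" using arg_cong[OF H(3), of transpose_mat] by simp
  show ?thesis
  proof (rule that[of "H1\<^sup>T" "H2\<^sup>T" K1 K2])
    fix v :: "'k vec" assume v: "v \<in> carrier_vec p"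
    have "A *\<^sub>v v = G *\<^sub>v (K *\<^sub>v v)" unfolding GK by (rule assoc_mult_mat_vec[OF G K v])
    also have "K *\<^sub>v v = K1 *\<^sub>v v @\<^sub>v K2 *\<^sub>v v"
      unfolding K12(3) by (rule mat_mult_append[OF K12(1,2) v])
    also have "G *\<^sub>v (K1 *\<^sub>v v @\<^sub>v K2 *\<^sub>v v) = H1\<^sup>T *\<^sub>v (K1 *\<^sub>v v) + H2\<^sup>T *\<^sub>v (K2 *\<^sub>v v)"
      unfolding G' by (rule transpose_append_rows_mult_vec[OF H(1,2)]) (use K12 v in auto)
    finally show "A *\<^sub>v v = H1\<^sup>T *\<^sub>v (K1 *\<^sub>v v) + H2\<^sup>T *\<^sub>v (K2 *\<^sub>v v)" .
  qed (use H K12 in auto)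
qed

context
  fixes emb :: "'k :: {field, finite} \<Rightarrow> 'e :: {field, finite}" and \<phi> :: "'e \<Rightarrow> 'k vec" and r :: nat
  assumes emb: "field_hom emb" and phi: "base_linear_iso emb r \<phi>"
begin

interpretation emb: field_hom emb by (rule emb)

lemma phi_carrier: "\<phi> x \<in> carrier_vec r"
  using phi by (auto simp: base_linear_iso_def bij_betw_def)

lemma phi_sum:
  assumes "j < r" "finite I"
  shows "\<phi> (\<Sum>i\<in>I. f i) $ j = (\<Sum>i\<in>I. \<phi> (f i) $ j)"
  using assms(2)
proof (induction rule: finite_induct)
  case empty
  have "\<phi> (emb 0 * 0) = 0 \<cdot>\<^sub>v \<phi> 0" using phi unfolding base_linear_iso_def by blast
  then have "\<phi> 0 = 0 \<cdot>\<^sub>v \<phi> 0" by simp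
  then have "\<phi> 0 $ j = (0 \<cdot>\<^sub>v \<phi> 0) $ j" by (rule arg_cong)
  then show ?case using assms(1) carrier_vecD[OF phi_carrier] by simp
next
  case (insert i I)
  have "\<phi> (f i + sum f I) = \<phi> (f i) + \<phi> (sum f I)" using phi by (simp add: base_linear_iso_def)
  then show ?case using insert assms(1) carrier_vecD[OF phi_carrier] by simp
qed

text \<open>\<open>\<phi>\<close> is linear over the small field, so a matrix over that field can be
  pulled out of the coordinates.\<close>

lemma coord_matrix_mult:
  assumes G: "G \<in> carrier_mat n d" and a: "a \<in> carrier_vec d"
  shows "coord_matrix \<phi> r (map_mat emb G *\<^sub>v a) = G * coord_matrix \<phi> r a"
proof (rule eq_matI)
  fix i j assume "i < dim_row (G * coord_matrix \<phi> r a)" "j < dim_col (G * coord_matrix \<phi> r a)"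
  then have ij: "i < n" "j < r" using G by (auto simp: coord_matrix_def)
  have smult: "\<phi> (emb c * x) $ j = c * \<phi> x $ j" for c x
    using phi ij(2) carrier_vecD[OF phi_carrier] by (simp add: base_linear_iso_def)
  show "coord_matrix \<phi> r (map_mat emb G *\<^sub>v a) $$ (i, j) = (G * coord_matrix \<phi> r a) $$ (i, j)"
    using G a ij by (simp add: coord_matrix_def scalar_prod_def phi_sum smult)
qed (use G in \<open>auto simp: coord_matrix_def\<close>)

lemma coord_matrix_inj:
  assumes x: "x \<in> carrier_vec n" and y: "y \<in> carrier_vec n" and eq: "coord_matrix \<phi> r x = coord_matrix \<phi> r y"
  shows "x = y"
proof (rule eq_vecI)
  fix i assume "i < dim_vec y"
  then have i: "i < n" using y by simp
  have "\<phi> (x $ i) $ j = \<phi> (y $ i) $ j" if "j < r" for j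
    using arg_cong[OF eq, of "\<lambda>M. M $$ (i, j)"] x y i that by (simp add: coord_matrix_def)
  then have "\<phi> (x $ i) = \<phi> (y $ i)" using carrier_vecD[OF phi_carrier] by (intro eq_vecI) auto
  then show "x $ i = y $ i" using phi by (auto simp: base_linear_iso_def bij_betw_def dest: injD)
qed (use x y in auto)

lemma coord_matrix_diff:
  assumes x: "x \<in> carrier_vec n" and y: "y \<in> carrier_vec n"
  shows "coord_matrix \<phi> r (x - y) = coord_matrix \<phi> r x - coord_matrix \<phi> r y"
proof (rule eq_matI)
  fix i j assume "i < dim_row (coord_matrix \<phi> r x - coord_matrix \<phi> r y)"
    "j < dim_col (coord_matrix \<phi> r x - coord_matrix \<phi> r y)"
  then have ij: "i < n" "j < r" using y by (auto simp: coord_matrix_def)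
  have "\<phi> (x $ i - y $ i + y $ i) = \<phi> (x $ i - y $ i) + \<phi> (y $ i)"
    using phi unfolding base_linear_iso_def by blast
  then have "\<phi> (x $ i) $ j = \<phi> (x $ i - y $ i) $ j + \<phi> (y $ i) $ j"
    using ij carrier_vecD[OF phi_carrier] by simp
  then show "coord_matrix \<phi> r (x - y) $$ (i, j) = (coord_matrix \<phi> r x - coord_matrix \<phi> r y) $$ (i, j)"
    using x y ij by (simp add: coord_matrix_def)
qed (use x y in \<open>auto simp: coord_matrix_def\<close>)

text \<open>If \<open>c\<close> is \<open>map_mat emb G\<close> applied to \<open>a\<close>, then
  \<open>G\<close> is a left factor of the coordinate matrix of \<open>c\<close>. Conversely,
  \<open>c\<close> is recovered from its coordinate matrix and a basis of the extension, and a
  factorization of that matrix yields \<open>G\<close>.\<close>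

lemma mem_mat_range_iff_card_coord_matrix:
  assumes c: "c \<in> carrier_vec n"
  shows "(\<exists>G \<in> carrier_mat n D. c \<in> mat_range (map_mat emb G)) \<longleftrightarrow>
           card (mat_range (coord_matrix \<phi> r c)) \<le> CARD('k) ^ D"
proof
  assume "\<exists>G \<in> carrier_mat n D. c \<in> mat_range (map_mat emb G)"
  then obtain G a where G: "G \<in> carrier_mat n D" and a: "a \<in> carrier_vec D" "c = map_mat emb G *\<^sub>v a"
    by (auto simp: mat_range_def)
  have "mat_range (coord_matrix \<phi> r c) \<subseteq> mat_range G"
    unfolding a(2) coord_matrix_mult[OF G a(1)] 
    by (rule mat_range_mult_subset[OF G coord_matrix_carrier[OF a(1)]])
  then have "card (mat_range (coord_matrix \<phi> r c)) \<le> card (mat_range G)"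
    by (rule card_mono[OF finite_linear_code[OF linear_code_mat_range[OF G]]])
  also have "\<dots> \<le> CARD('k) ^ D" by (rule card_mat_range_le[OF G])
  finally show "card (mat_range (coord_matrix \<phi> r c)) \<le> CARD('k) ^ D" .
next
  let ?M = "coord_matrix \<phi> r c"
  have M: "?M \<in> carrier_mat n r" using c by simp
  \<comment> \<open>The entries of \<open>b\<close> are the basis of the extension that
    \<open>\<phi>\<close> sends to the unit vectors, so the coordinate matrix of \<open>b\<close> is
    the identity.\<close>
  define b where "b = vec r (\<lambda>i. inv_into UNIV \<phi> (unit_vec r i))"
  have b: "b \<in> carrier_vec r" by (simp add: b_def)
  have "\<phi> (inv_into UNIV \<phi> u) = u" if "u \<in> carrier_vec r" for u
    using phi that by (simp add: base_linear_iso_def bij_betw_def f_inv_into_f)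
  then have "coord_matrix \<phi> r b = 1\<^sub>m r"
    by (intro eq_matI) (auto simp: coord_matrix_def b_def)
  then have cb: "c = map_mat emb ?M *\<^sub>v b"
    using coord_matrix_mult[OF M b] M b mult_mat_vec_carrier[of "map_mat emb ?M" n r b]
    by (intro coord_matrix_inj[OF c]) auto
  assume "card (mat_range ?M) \<le> CARD('k) ^ D"
  then obtain G K where G: "G \<in> carrier_mat n D" and K: "K \<in> carrier_mat D r" and GK: "?M = G * K"
    by (rule rank_factorization[OF M])
  have "c \<in> mat_range (map_mat emb ?M)" using cb b M by (auto simp: mat_range_def)
  then show "\<exists>G \<in> carrier_mat n D. c \<in> mat_range (map_mat emb G)"
    using mat_range_map_mat_mult_subset[OF emb G K] G unfolding GK[symmetric] by blast
qed

section \<open>Collisions of received matrices and the rank of the difference\<close>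

lemma transpose_lift_vec_mult:
  assumes x: "x \<in> carrier_vec n" and a: "a \<in> carrier_vec n" and b: "b \<in> carrier_vec r"
  shows "(lift_vec \<phi> r n x)\<^sup>T *\<^sub>v (a @\<^sub>v b) = a + coord_matrix \<phi> r x *\<^sub>v b"
proof -
  have "(coord_matrix \<phi> r x)\<^sup>T \<in> carrier_mat r n" using x by simp
  from transpose_append_rows_mult_vec[OF _ this a b, of "1\<^sub>m n"] show ?thesis
    using a by (simp add: lift_vec_eq[OF x phi_carrier])
qed

lemma lift_vec_carrier: "x \<in> carrier_vec n \<Longrightarrow> lift_vec \<phi> r n x \<in> carrier_mat (n + r) n"
  by (simp add: lift_vec_eq[OF _ phi_carrier] carrier_append_rows)

text \<open>After \<open>A'\<close> is eliminated, each value of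
  \<open>A * coord_matrix \<phi> r (x - x')\<close> has the form
  \<open>D' *\<^sub>v u' - D *\<^sub>v u\<close>. There are \<open>CARD('k) ^ t\<close> choices for
  each of \<open>u\<close> and \<open>u'\<close>.\<close>

lemma collision_imp_card_le:
  assumes x: "x \<in> carrier_vec n" and x': "x' \<in> carrier_vec n"
    and A: "A \<in> carrier_mat N n" and A': "A' \<in> carrier_mat N n"
    and D: "D \<in> carrier_mat N t" and D': "D' \<in> carrier_mat N t"
    and Z: "Z \<in> carrier_mat (n + r) t" and Z': "Z' \<in> carrier_mat (n + r) t"
    and eq: "A * (lift_vec \<phi> r n x)\<^sup>T + D * Z\<^sup>T = A' * (lift_vec \<phi> r n x')\<^sup>T + D' * Z'\<^sup>T"
  shows "card (mat_range (A * coord_matrix \<phi> r (x - x'))) \<le> CARD('k) ^ (2 * t)"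
proof -
  let ?M = "coord_matrix \<phi> r" and ?X = "\<lambda>x. (lift_vec \<phi> r n x)\<^sup>T"
  let ?d = "\<lambda>(u, u'). D' *\<^sub>v u' - D *\<^sub>v u"
  have M: "?M x \<in> carrier_mat n r" "?M x' \<in> carrier_mat n r" using x x' by simp_all
  have c: "x - x' \<in> carrier_vec n" using x x' by simp
  have X: "?X x \<in> carrier_mat n (n + r)" "?X x' \<in> carrier_mat n (n + r)"
    using lift_vec_carrier[OF x] lift_vec_carrier[OF x'] by auto
  have ZT: "Z\<^sup>T \<in> carrier_mat t (n + r)" "Z'\<^sup>T \<in> carrier_mat t (n + r)" using Z Z' by auto
  have "(A * ?M (x - x')) *\<^sub>v v \<in> ?d ` (carrier_vec t \<times> carrier_vec t)" if v: "v \<in> carrier_vec r" for v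
  proof -
    \<comment> \<open>The vector \<open>w\<close> lies in the kernel of \<open>?X x'\<close>, which
      removes the second transfer matrix, while \<open>?X x\<close> sends it to
      \<open>?M (x - x') *\<^sub>v v\<close>.\<close>
    define w where "w = - (?M x' *\<^sub>v v) @\<^sub>v v"
    have Mv: "?M x *\<^sub>v v \<in> carrier_vec n" "?M x' *\<^sub>v v \<in> carrier_vec n" using M v by auto
    have w: "w \<in> carrier_vec (n + r)" using Mv v by (simp add: w_def)
    have Xw: "?X y *\<^sub>v w = - (?M x' *\<^sub>v v) + ?M y *\<^sub>v v" if "y \<in> carrier_vec n" for y
      unfolding w_def by (rule transpose_lift_vec_mult[OF that]) (use Mv v in auto)
    have "?X x *\<^sub>v w = ?M (x - x') *\<^sub>v v"
      unfolding Xw[OF x] coord_matrix_diff[OF x x'] minus_mult_distrib_mat_vec[OF M v]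
      using comm_add_vec[of "- (?M x' *\<^sub>v v)" n "?M x *\<^sub>v v"] minus_add_uminus_vec[OF Mv] Mv by simp
    moreover have "?X x' *\<^sub>v w = 0\<^sub>v n" unfolding Xw[OF x'] by (rule uminus_l_inv_vec[OF Mv(2)])
    moreover have "(A * ?X x + D * Z\<^sup>T) *\<^sub>v w = A *\<^sub>v (?X x *\<^sub>v w) + D *\<^sub>v (Z\<^sup>T *\<^sub>v w)"
      using add_mult_distrib_mat_vec[OF mult_carrier_mat[OF A X(1)] mult_carrier_mat[OF D ZT(1)] w]
        assoc_mult_mat_vec[OF A X(1) w] assoc_mult_mat_vec[OF D ZT(1) w] by simp
    moreover have "(A' * ?X x' + D' * Z'\<^sup>T) *\<^sub>v w = A' *\<^sub>v (?X x' *\<^sub>v w) + D' *\<^sub>v (Z'\<^sup>T *\<^sub>v w)"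
      using add_mult_distrib_mat_vec[OF mult_carrier_mat[OF A' X(2)] mult_carrier_mat[OF D' ZT(2)] w]
        assoc_mult_mat_vec[OF A' X(2) w] assoc_mult_mat_vec[OF D' ZT(2) w] by simp
    moreover have "A' *\<^sub>v 0\<^sub>v n = 0\<^sub>v N" using A' by (intro eq_vecI) auto
    ultimately have e: "A *\<^sub>v (?M (x - x') *\<^sub>v v) + D *\<^sub>v (Z\<^sup>T *\<^sub>v w) = 0\<^sub>v N + D' *\<^sub>v (Z'\<^sup>T *\<^sub>v w)"
      using eq by metis
    have "(A *\<^sub>v (?M (x - x') *\<^sub>v v)) $ i = (D' *\<^sub>v (Z'\<^sup>T *\<^sub>v w)) $ i - (D *\<^sub>v (Z\<^sup>T *\<^sub>v w)) $ i"
      if "i < N" for i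
      using arg_cong[OF e, of "\<lambda>u. u $ i"] that A D D' by (simp add: algebra_simps del: index_mult_mat_vec)
    then have "A *\<^sub>v (?M (x - x') *\<^sub>v v) = ?d (Z\<^sup>T *\<^sub>v w, Z'\<^sup>T *\<^sub>v w)"
      using A D D' by (intro eq_vecI) (auto simp del: index_mult_mat_vec)
    moreover have "(A * ?M (x - x')) *\<^sub>v v = A *\<^sub>v (?M (x - x') *\<^sub>v v)"
      by (rule assoc_mult_mat_vec[OF A _ v]) (use c in simp)
    moreover have "(Z\<^sup>T *\<^sub>v w, Z'\<^sup>T *\<^sub>v w) \<in> carrier_vec t \<times> carrier_vec t" using ZT w by auto
    ultimately show ?thesis by (metis imageI)
  qed
  then have "mat_range (A * ?M (x - x')) \<subseteq> ?d ` (carrier_vec t \<times> carrier_vec t)"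
    unfolding mat_range_eq[OF mult_carrier_mat[OF A coord_matrix_carrier[OF c]]] by blast
  then have "card (mat_range (A * ?M (x - x'))) \<le> card (?d ` (carrier_vec t \<times> carrier_vec t))"
    by (rule card_mono[rotated]) simp
  also have "\<dots> \<le> card (carrier_vec t \<times> carrier_vec t :: ('k vec \<times> 'k vec) set)"
    by (rule card_image_le) simp
  also have "\<dots> = CARD('k) ^ (2 * t)" by (simp add: card_cartesian_product card_carrier_vec mult_2 power_add)
  finally show ?thesis .
qed

text \<open>The same transfer matrix serves both packets, so the identity blocks cancel and only
  \<open>A * coord_matrix \<phi> r (x - x')\<close> must be compensated. Its rank is at most
  \<open>2 * t\<close>, and each receiver equation absorbs \<open>t\<close> of it.\<close>

lemma card_le_imp_collision:
  assumes x: "x \<in> carrier_vec n" and x': "x' \<in> carrier_vec n" and A: "A \<in> carrier_mat N n"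
    and card: "card (mat_range (A * coord_matrix \<phi> r (x - x'))) \<le> CARD('k) ^ (2 * t)"
  shows "\<exists>D \<in> carrier_mat N t. \<exists>D' \<in> carrier_mat N t.
           \<exists>Z \<in> carrier_mat (n + r) t. \<exists>Z' \<in> carrier_mat (n + r) t.
             A * (lift_vec \<phi> r n x)\<^sup>T + D * Z\<^sup>T = A * (lift_vec \<phi> r n x')\<^sup>T + D' * Z'\<^sup>T"
proof -
  let ?M = "coord_matrix \<phi> r" and ?X = "\<lambda>x. (lift_vec \<phi> r n x)\<^sup>T"
  have M: "?M x \<in> carrier_mat n r" "?M x' \<in> carrier_mat n r" using x x' by simp_all
  have c: "?M (x - x') \<in> carrier_mat n r" using x x' by simp
  have X: "?X x \<in> carrier_mat n (n + r)" "?X x' \<in> carrier_mat n (n + r)"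
    using lift_vec_carrier[OF x] lift_vec_carrier[OF x'] by auto
  have AM: "A * ?M (x - x') \<in> carrier_mat N r" using A c by simp
  have "card (mat_range (A * ?M (x - x'))) \<le> CARD('k) ^ (t + t)" using card by (simp add: mult_2)
  then obtain D D' K K' where D: "D \<in> carrier_mat N t" "D' \<in> carrier_mat N t"
    and K: "K \<in> carrier_mat t r" "K' \<in> carrier_mat t r"
    and DK: "\<And>v. v \<in> carrier_vec r \<Longrightarrow> (A * ?M (x - x')) *\<^sub>v v = D *\<^sub>v (K *\<^sub>v v) + D' *\<^sub>v (K' *\<^sub>v v)"
    by (rule rank_factorization_split[OF AM]) blast
  \<comment> \<open>The errors vanish on the coordinates of the identity block. The sign of
    \<open>K\<close> differs from that of \<open>K'\<close> because the two error terms stand on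
    opposite sides of the equation.\<close>
  define Z where "Z = 0\<^sub>m n t @\<^sub>r (- K)\<^sup>T"
  define Z' where "Z' = 0\<^sub>m n t @\<^sub>r K'\<^sup>T"
  have Z: "Z \<in> carrier_mat (n + r) t" "Z' \<in> carrier_mat (n + r) t"
    using K by (auto simp: Z_def Z'_def intro!: carrier_append_rows)
  have ZT: "Z\<^sup>T \<in> carrier_mat t (n + r)" "Z'\<^sup>T \<in> carrier_mat t (n + r)" using Z by auto
  have "A * ?X x + D * Z\<^sup>T = A * ?X x' + D' * Z'\<^sup>T"
  proof (rule eq_matI_mult_vec)
    show "A * ?X x + D * Z\<^sup>T \<in> carrier_mat N (n + r)" "A * ?X x' + D' * Z'\<^sup>T \<in> carrier_mat N (n + r)"
      using A X D ZT by auto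
    fix w :: "'k vec" assume w: "w \<in> carrier_vec (n + r)"
    define a b where "a = vec_first w n" and "b = vec_last w r"
    have ab: "a \<in> carrier_vec n" "b \<in> carrier_vec r" "w = a @\<^sub>v b"
      using w by (auto simp: a_def b_def vec_first_last_append)
    have Mb: "?M x *\<^sub>v b \<in> carrier_vec n" "?M x' *\<^sub>v b \<in> carrier_vec n" using M ab by auto
    have zero: "0\<^sub>m t n *\<^sub>v a = (0\<^sub>v t :: 'k vec)" by (rule zero_mult_mat_vec[OF ab(1)])
    have "Z\<^sup>T *\<^sub>v w = (0\<^sub>m n t)\<^sup>T *\<^sub>v a + (- K) *\<^sub>v b"
      unfolding Z_def ab(3) using transpose_append_rows_mult_vec[of "0\<^sub>m n t" n t "(- K)\<^sup>T" r a b] K ab by simp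
    then have Zw: "Z\<^sup>T *\<^sub>v w = - (K *\<^sub>v b)" using K ab zero by simp
    have "Z'\<^sup>T *\<^sub>v w = (0\<^sub>m n t)\<^sup>T *\<^sub>v a + K' *\<^sub>v b"
      unfolding Z'_def ab(3) using transpose_append_rows_mult_vec[of "0\<^sub>m n t" n t "K'\<^sup>T" r a b] K ab by simp
    then have Zw': "Z'\<^sup>T *\<^sub>v w = K' *\<^sub>v b" using K ab zero by simp
    have Xw: "?X y *\<^sub>v w = a + ?M y *\<^sub>v b" if "y \<in> carrier_vec n" for y
      unfolding ab(3) by (rule transpose_lift_vec_mult[OF that ab(1,2)])
    have "A *\<^sub>v (?M x *\<^sub>v b) - A *\<^sub>v (?M x' *\<^sub>v b) = A *\<^sub>v (?M x *\<^sub>v b - ?M x' *\<^sub>v b)"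
      by (rule mult_minus_distrib_mat_vec[OF A Mb, symmetric])
    also have "\<dots> = A *\<^sub>v (?M (x - x') *\<^sub>v b)"
      unfolding coord_matrix_diff[OF x x'] minus_mult_distrib_mat_vec[OF M ab(2)] ..
    also have "\<dots> = (A * ?M (x - x')) *\<^sub>v b" by (rule assoc_mult_mat_vec[OF A c ab(2), symmetric])
    finally have diff: "A *\<^sub>v (?M x *\<^sub>v b) - A *\<^sub>v (?M x' *\<^sub>v b) = D *\<^sub>v (K *\<^sub>v b) + D' *\<^sub>v (K' *\<^sub>v b)"
      by (simp only: DK[OF ab(2)])
    have e: "(A *\<^sub>v (?M x *\<^sub>v b)) $ i - (A *\<^sub>v (?M x' *\<^sub>v b)) $ i = (D *\<^sub>v (K *\<^sub>v b)) $ i + (D' *\<^sub>v (K' *\<^sub>v b)) $ i"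
      if "i < N" for i
      using arg_cong[OF diff, of "\<lambda>v. v $ i"] that A D by (simp del: index_mult_mat_vec)
    have "A *\<^sub>v (a + ?M x *\<^sub>v b) + D *\<^sub>v (- (K *\<^sub>v b)) = A *\<^sub>v (a + ?M x' *\<^sub>v b) + D' *\<^sub>v (K' *\<^sub>v b)"
    proof -
      have "D *\<^sub>v (- (K *\<^sub>v b)) = - (D *\<^sub>v (K *\<^sub>v b))"
        using D K ab by (intro eq_vecI) auto
      then show ?thesis
        unfolding mult_add_distrib_mat_vec[OF A ab(1) Mb(1)] mult_add_distrib_mat_vec[OF A ab(1) Mb(2)]
        using A D e by (intro eq_vecI) (auto simp: algebra_simps simp del: index_mult_mat_vec)
    qed
    then show "(A * ?X x + D * Z\<^sup>T) *\<^sub>v w = (A * ?X x' + D' * Z'\<^sup>T) *\<^sub>v w"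
      using add_mult_distrib_mat_vec[OF mult_carrier_mat[OF A X(1)] mult_carrier_mat[OF D(1) ZT(1)] w]
        add_mult_distrib_mat_vec[OF mult_carrier_mat[OF A X(2)] mult_carrier_mat[OF D(2) ZT(2)] w]
        assoc_mult_mat_vec[OF A X(1) w] assoc_mult_mat_vec[OF D(1) ZT(1) w]
        assoc_mult_mat_vec[OF A X(2) w] assoc_mult_mat_vec[OF D(2) ZT(2) w]
      by (simp only: Xw[OF x] Xw[OF x'] Zw Zw')
  qed
  then show ?thesis using D Z by blast
qed

end

theorem proposition40:
  fixes emb :: "'k :: {field, finite} \<Rightarrow> 'e :: {field, finite}"
    and \<phi> :: "'e \<Rightarrow> 'k vec"
    and \<psi> :: "'e vec \<Rightarrow> 'e vec set"
    and C1 C2 :: "'e vec set"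
    and m n l t \<rho> N :: nat
  assumes "m > n"
    and "finite_field_extension emb (m - n)"
    and "base_linear_iso emb (m - n) \<phi>"
    and "linear_code n C1"
    and "linear_code n C2"
    and "C2 \<subset> C1"
    and "int (subspace_dim n C2) = int (subspace_dim n C1) - int l"
    and "l \<ge> 1"
    and "coset_encoder n l C1 C2 \<psi>"
    and "\<rho> \<le> n"
    and "N \<ge> n - \<rho>"
  shows "noncoherent_universally_correcting t \<rho> N m n l (lifted_packets \<phi> (m - n) n \<psi>)
         \<longleftrightarrow> relative_rank_weight1 CARD('k) n C1 C2 > 2 * t + \<rho>"
proof -
  let ?r = "m - n"
  let ?M = "coord_matrix \<phi> ?r"
  have emb: "field_hom emb" using assms(2) by (simp add: finite_field_extension_def)
  have m: "n + ?r = m" using assms(1) by simp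
  note phi = assms(3) and C1 = assms(4) and C2 = assms(5) and sub = assms(6) and enc = assms(9)
  have C1c: "C1 \<subseteq> carrier_vec n" using C1 by (simp add: linear_code_iff)
  \<comment> \<open>Both the weight bound and the existence of a suitable transfer matrix say that
    some \<open>?M c\<close> has rank at most \<open>2 * t + \<rho>\<close>.\<close>
  have "relative_rank_weight1 CARD('k) n C1 C2 \<le> 2 * t + \<rho> \<longleftrightarrow>
      (\<exists>c \<in> C1 - C2. \<exists>A \<in> transfer_matrices N n \<rho>. card (mat_range (A * ?M c)) \<le> CARD('k) ^ (2 * t))"
  proof -
    have "(\<exists>G \<in> carrier_mat n (2 * t + \<rho>). c \<in> mat_range (map_mat emb G)) \<longleftrightarrow>
        (\<exists>A \<in> transfer_matrices N n \<rho>. card (mat_range (A * ?M c)) \<le> CARD('k) ^ (2 * t))" if "c \<in> C1 - C2" for c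
    proof -
      have c: "c \<in> carrier_vec n" using that C1c by blast
      show ?thesis
        unfolding mem_mat_range_iff_card_coord_matrix[OF emb phi c]
          exists_transfer_matrix_iff[OF coord_matrix_carrier[OF c] assms(10,11)] ..
    qed
    then show ?thesis unfolding relative_rank_weight1_le_iff[OF emb C1 C2 sub] by blast
  qed
  moreover have "\<not> noncoherent_universally_correcting t \<rho> N m n l (lifted_packets \<phi> ?r n \<psi>)"
    if c': "c \<in> C1 - C2" and A': "A \<in> transfer_matrices N n \<rho>" and le: "card (mat_range (A * ?M c)) \<le> CARD('k) ^ (2 * t)" for c A
  proof -
    obtain S S' where S: "S \<in> carrier_vec l" "S' \<in> carrier_vec l" "S \<noteq> S'" "c \<in> \<psi> S" "0\<^sub>v n \<in> \<psi> S'"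
      by (rule coset_encoder_separates[OF enc C1 C2 sub c'])
    have c: "c \<in> carrier_vec n" using c' C1c by blast
    have A: "A \<in> carrier_mat N n" using A' by (simp add: transfer_matrices_def)
    \<comment> \<open>The collision is built between \<open>c\<close> and the zero codeword, whose
      difference is \<open>c\<close>.\<close>
    have "card (mat_range (A * ?M (c - 0\<^sub>v n))) \<le> CARD('k) ^ (2 * t)" using le c by simp
    from card_le_imp_collision[OF emb phi c zero_carrier_vec A this]
    show ?thesis
      using S A' unfolding noncoherent_universally_correcting_def lifted_packets_def m by blast
  qed
  moreover have "\<exists>c \<in> C1 - C2. \<exists>A \<in> transfer_matrices N n \<rho>. card (mat_range (A * ?M c)) \<le> CARD('k) ^ (2 * t)"
    if collision: "\<not> noncoherent_universally_correcting t \<rho> N m n l (lifted_packets \<phi> ?r n \<psi>)"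
  proof -
    obtain S S' x x' A A' D D' Z Z' where S: "S \<in> carrier_vec l" "S' \<in> carrier_vec l" "S \<noteq> S'"
      and x: "x \<in> \<psi> S" "x' \<in> \<psi> S'"
      and A: "A \<in> transfer_matrices N n \<rho>" "A' \<in> transfer_matrices N n \<rho>"
      and DZ: "D \<in> carrier_mat N t" "D' \<in> carrier_mat N t" "Z \<in> carrier_mat m t" "Z' \<in> carrier_mat m t"
      and eq: "A * (lift_vec \<phi> ?r n x)\<^sup>T + D * Z\<^sup>T = A' * (lift_vec \<phi> ?r n x')\<^sup>T + D' * Z'\<^sup>T"
      using collision unfolding noncoherent_universally_correcting_def lifted_packets_def by blast
    note d = coset_encoder_diff[OF enc C1 C2 sub S x]
    have "card (mat_range (A * ?M (x - x'))) \<le> CARD('k) ^ (2 * t)"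
      using A DZ d(1,2) C1c
      by (intro collision_imp_card_le[OF emb phi _ _ _ _ _ _ _ _ eq]) (auto simp: transfer_matrices_def m)
    then show ?thesis using d(3) A(1) by blast
  qed
  ultimately show ?thesis by (meson not_le)
qed

end
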